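(* Let $0<\varepsilon\le 1/250$ be fixed. Assume $\textsf{ALG}$ is a randomized sample-based algorithm that, for any function $f:\{0,1\}^n\to\{0,1\}$ and any distribution $\mathcal{D}$ over $\{0,1\}^n$, when given as input a sequence $S=\{(y^{(k)},f(y^{(k)}))\}_{k\in[m]}$ with $y^{(1)},\dots,y^{(m)}$ drawn i.i.d. from $\mathcal{D}$, satisfies: if $f$ is a monotone conjunction then $\Pr_{\textsf{ALG},S}[\textsf{ALG}(S)=1]\ge5/6$; and if $f$ is $\varepsilon$-far from linear threshold functions under $\mathcal{D}$ then $\Pr_{\textsf{ALG},S}[\textsf{ALG}(S)=0]\ge 5/6$. Then $m=\Omega(n/\log^3 n)$.
   Context: A monotone conjunction is a function $x\mapsto\bigwedge_{i\in E}x_i$ for some $E\subseteq[n]$. A linear threshold function is $g(x)=\mathbb{1}[w\cdot x\ge\theta]$ for some $w\in\mathbb{R}^n,\theta\in\mathbb{R}$. $f$ is $\varepsilon$-far from linear threshold functions under $\mathcal{D}$ if $\Pr_{x\sim\mathcal{D}}[f(x)\ne g(x)]\ge\varepsilon$ for every linear threshold function $g$. *)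

theory Defs
  imports "HOL-Probability.Probability"
begin

text \<open>
  Points of the cube \<open>{0,1}\<^sup>n\<close> are Boolean lists of length \<open>n\<close>, with coordinates indexed by
  \<open>{..<n}\<close>. Functions on the cube are functions on all Boolean lists; every notion below depends
  only on their values on lists of length \<open>n\<close>. Outputs \<open>1\<close> and \<open>0\<close> are \<open>True\<close> and \<open>False\<close>.
\<close>

definition cube :: "nat \<Rightarrow> bool list set" where
  "cube n = {x. length x = n}"

definition monotone_conjunction :: "nat \<Rightarrow> (bool list \<Rightarrow> bool) \<Rightarrow> bool" where
  "monotone_conjunction n f \<longleftrightarrow> (\<exists>E\<subseteq>{..<n}. \<forall>x\<in>cube n. f x \<longleftrightarrow> (\<forall>i\<in>E. x ! i))"

definition linear_threshold :: "nat \<Rightarrow> (bool list \<Rightarrow> bool) \<Rightarrow> bool" where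
  "linear_threshold n g \<longleftrightarrow>
     (\<exists>(w :: nat \<Rightarrow> real) (\<theta> :: real). \<forall>x\<in>cube n. g x \<longleftrightarrow> (\<Sum>i<n. w i * of_bool (x ! i)) \<ge> \<theta>)"

definition far_from_ltf :: "nat \<Rightarrow> real \<Rightarrow> bool list pmf \<Rightarrow> (bool list \<Rightarrow> bool) \<Rightarrow> bool" where
  "far_from_ltf n \<epsilon> D f \<longleftrightarrow>
     (\<forall>g. linear_threshold n g \<longrightarrow> measure_pmf.prob D {x. f x \<noteq> g x} \<ge> \<epsilon>)"

text \<open>
  A randomized sample-based algorithm maps the labelled sample sequence to the distribution of its
  output bit. The following is the law of that output under the joint randomness of the \<open>m\<close> i.i.d.
  samples and of the algorithm.
\<close>

definition run_on_samples ::
    "((bool list \<times> bool) list \<Rightarrow> bool pmf) \<Rightarrow> nat \<Rightarrow> bool list pmf \<Rightarrow> (bool list \<Rightarrow> bool) \<Rightarrow> bool pmf" where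
  "run_on_samples ALG m D f =
     bind_pmf (replicate_pmf m D) (\<lambda>ys. ALG (map (\<lambda>y. (y, f y)) ys))"

definition conjunction_vs_ltf_tester ::
    "nat \<Rightarrow> real \<Rightarrow> nat \<Rightarrow> ((bool list \<times> bool) list \<Rightarrow> bool pmf) \<Rightarrow> bool" where
  "conjunction_vs_ltf_tester n \<epsilon> m ALG \<longleftrightarrow>
     (\<forall>f D. set_pmf D \<subseteq> cube n \<longrightarrow>
        (monotone_conjunction n f \<longrightarrow> pmf (run_on_samples ALG m D f) True \<ge> 5 / 6) \<and>
        (far_from_ltf n \<epsilon> D f \<longrightarrow> pmf (run_on_samples ALG m D f) False \<ge> 5 / 6))"

end

theory Submission
  imports Defs "HOL-Computational_Algebra.Polynomial" "HOL-Real_Asymp.Real_Asymp"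
begin

text \<open>
  All instances use the same labelling, the XNOR of the first two coordinates; only the distribution
  varies. It gives random independent weights to \<open>4 n\<^sup>2\<close> points, which come in groups of four that
  differ in the first two coordinates only. If all four points of most groups have about equal weight,
  every linear threshold function errs on a constant fraction, since XNOR is not linearly separable.
  If only about \<open>n / log n\<close> points have nonzero weight, then, the other coordinates forming a random
  code, each negative point has a zero that no positive point of the support shares, so
  the labelling agrees with a monotone conjunction on the support.

  The two weight laws have the same first \<open>O(log n)\<close> moments. The acceptance probability of the tester
  is, up to a thinning of the samples, polynomial in each weight, and its coefficients of higher
  degree are negligible for \<open>m\<close> below \<open>c n / log\<^sup>2 n\<close>; so both laws lead to nearly the same
  acceptance probability.
\<close>

section \<open>Distributions with matching moments\<close>

text \<open>The logarithms arise as follows. A code with \<open>t\<close> columns, \<open>t\<close>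
  of order log n, leaves about \<open>n / t\<close> symbols \<open>q\<close> per column, and it
  separates supports of at most \<open>q / 4\<close> points. Both laws have the same mean, near 1,
  so with \<open>4 K\<close> points the sparse law needs typical weights of order
  \<open>a = 640 K / q\<close>. Each of the \<open>4 K\<close> exchanges of a weight costs
  \<open>4 ^ - L\<close>, which makes \<open>L\<close> of order log n as well. The nodes are
  squares, spaced like Chebyshev nodes near an endpoint, so \<open>L\<close> moments cost only a
  factor \<open>L^2\<close> in the largest weight \<open>M\<close>, of order \<open>a L^2\<close>. A
  trial succeeds with probability at least \<open>1 / (8 M)\<close>, and the exchange tolerates
  \<open>K L / 8\<close> trials; hence \<open>m\<close> may be of order \<open>K L / M\<close>, that
  is \<open>q / L\<close> or n / log^2 n. The logarithm left over in the statement absorbs the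
  constants.

  The number of groups is quadratic in \<open>n\<close> by a birthday bound: two points of one group
  share their code, so the code cannot separate them, and the support of the sparse law should meet
  each group at most once.\<close>

text \<open>The sum is the coefficient of degree \<open>card I - 1\<close> in the Lagrange
  interpolant of \<open>x ^ l\<close> at the nodes. That interpolant is \<open>monom 1 l\<close>
  itself, whose degree is smaller.\<close>

lemma lagrange_weights_annihilate:
  fixes x :: "'i \<Rightarrow> real"
  assumes fin: "finite I" and inj: "inj_on x I" and l: "Suc l < card I"
  shows "(\<Sum>j\<in>I. x j ^ l / (\<Prod>i\<in>I-{j}. x j - x i)) = 0"
proof -
  define B where "B j = (\<Prod>i\<in>I-{j}. [:- x i, 1:])" for j
  define d where "d j = (\<Prod>i\<in>I-{j}. x j - x i)" for j
  define p where "p = (\<Sum>j\<in>I. smult (x j ^ l / d j) (B j))"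
  have degB: "degree (B j) = card I - 1" if "j \<in> I" for j
    unfolding B_def using fin that by (subst degree_prod_eq_sum_degree) auto
  have dnz: "d j \<noteq> 0" if "j \<in> I" for j
    using that fin inj by (auto simp: d_def inj_on_def)
  have poly_B: "poly (B j) (x k) = (if k = j then d j else 0)" if "j \<in> I" "k \<in> I" for j k
    using that fin by (auto simp: B_def d_def poly_prod)
  have "p = monom 1 l"
  proof (rule poly_eqI_degree[where A = "x ` I"])
    fix y assume "y \<in> x ` I"
    then obtain k where k: "k \<in> I" "y = x k" by auto
    have "poly p y = (\<Sum>j\<in>I. x j ^ l / d j * (if k = j then d j else 0))"
      unfolding p_def poly_sum using k by (intro sum.cong) (auto simp: poly_B)
    also have "\<dots> = x k ^ l"
      using fin k dnz by (simp add: if_distrib cong: if_cong)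
    finally show "poly p y = poly (monom 1 l) y"
      by (simp add: k poly_monom)
  next
    have "degree p \<le> card I - 1"
      unfolding p_def using fin degB
      by (intro degree_sum_le) (auto intro: order.trans[OF degree_smult_le])
    then show "degree p < card (x ` I)"
      using l inj by (simp add: card_image)
    show "degree (monom 1 l :: real poly) < card (x ` I)"
      using l inj by (simp add: card_image degree_monom_eq)
  qed
  moreover have "coeff p (card I - 1) = (\<Sum>j\<in>I. x j ^ l / d j)"
  proof -
    have "coeff (B j) (card I - 1) = 1" if "j \<in> I" for j
    proof -
      have "lead_coeff (B j) = 1"
        unfolding B_def by (subst lead_coeff_prod) simp
      then show ?thesis using degB that by simp
    qed
    then show ?thesis
      by (simp add: p_def coeff_sum)
  qed
  moreover have "coeff (monom 1 l :: real poly) (card I - 1) = 0"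
    using l by simp
  ultimately show ?thesis
    by (simp add: d_def)
qed

text \<open>For increasing nodes exactly \<open>N - j\<close> factors of the product at
  \<open>j\<close> are negative, so the Lagrange weights alternate in sign. Moving the odd indices
  to the other side leaves two positive measures with equal moments of every order below
  \<open>N\<close>.\<close>

lemma alternating_lagrange_weights_annihilate:
  fixes x :: "nat \<Rightarrow> real"
  assumes mono: "strict_mono_on {..N} x" and l: "l < N"
  shows "(\<Sum>j\<le>N. (-1) ^ j * x j ^ l / (\<Prod>i\<in>{..N}-{j}. \<bar>x j - x i\<bar>)) = 0"
proof -
  have less: "x i < x j" if "i < j" "j \<le> N" for i j
    using mono that by (auto simp: strict_mono_on_def)
  have prod_eq: "(\<Prod>i\<in>{..N}-{j}. x j - x i) = (-1) ^ (N - j) * (\<Prod>i\<in>{..N}-{j}. \<bar>x j - x i\<bar>)"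
    if "j \<le> N" for j
  proof -
    have split: "{..N} - {j} = {..<j} \<union> {j<..N}" using that by auto
    have "(\<Prod>i\<in>{..N}-{j}. x j - x i) = (\<Prod>i<j. x j - x i) * (\<Prod>i\<in>{j<..N}. x j - x i)"
      unfolding split by (rule prod.union_disjoint) auto
    also have "(\<Prod>i<j. x j - x i) = (\<Prod>i<j. \<bar>x j - x i\<bar>)"
      using less that by (intro prod.cong) (auto simp: less_imp_le)
    also have "(\<Prod>i\<in>{j<..N}. x j - x i) = (\<Prod>i\<in>{j<..N}. (-1) * \<bar>x j - x i\<bar>)"
      using less by (intro prod.cong) (auto simp: less_imp_le)
    also have "\<dots> = (-1) ^ (N - j) * (\<Prod>i\<in>{j<..N}. \<bar>x j - x i\<bar>)"
      by (subst prod.distrib) simp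
    also have "(\<Prod>i<j. \<bar>x j - x i\<bar>) * ((-1) ^ (N - j) * (\<Prod>i\<in>{j<..N}. \<bar>x j - x i\<bar>))
      = (-1) ^ (N - j) * (\<Prod>i\<in>{..N}-{j}. \<bar>x j - x i\<bar>)"
      unfolding split by (subst prod.union_disjoint) auto
    finally show ?thesis .
  qed
  have "inj_on x {..N}"
    using mono by (rule strict_mono_on_imp_inj_on)
  then have "(\<Sum>j\<le>N. x j ^ l / (\<Prod>i\<in>{..N}-{j}. x j - x i)) = 0"
    using l by (intro lagrange_weights_annihilate) auto
  also have "(\<Sum>j\<le>N. x j ^ l / (\<Prod>i\<in>{..N}-{j}. x j - x i)) =
    (-1) ^ N * (\<Sum>j\<le>N. (-1) ^ j * x j ^ l / (\<Prod>i\<in>{..N}-{j}. \<bar>x j - x i\<bar>))"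
    unfolding sum_distrib_left
  proof (intro sum.cong refl)
    fix j assume "j \<in> {..N}"
    then have j: "j \<le> N" by simp
    have sgn: "(-1::real) ^ (N - j) = (-1) ^ N * (-1) ^ j"
    proof -
      have "(-1::real) ^ N = (-1) ^ (N - j) * (-1) ^ j"
        using j by (simp add: power_add[symmetric])
      then show ?thesis by (simp add: power_mult_distrib[symmetric])
    qed
    have "x j ^ l / (\<Prod>i\<in>{..N}-{j}. x j - x i)
        = x j ^ l / ((-1) ^ (N - j) * (\<Prod>i\<in>{..N}-{j}. \<bar>x j - x i\<bar>))"
      using prod_eq[OF j] by simp
    also have "\<dots> = (-1) ^ (N - j) * (x j ^ l / (\<Prod>i\<in>{..N}-{j}. \<bar>x j - x i\<bar>))"
      by (cases "even (N - j)") auto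
    finally show "x j ^ l / (\<Prod>i\<in>{..N}-{j}. x j - x i)
        = (-1) ^ N * ((-1) ^ j * x j ^ l / (\<Prod>i\<in>{..N}-{j}. \<bar>x j - x i\<bar>))"
      by (simp add: sgn)
  qed
  finally show ?thesis by simp
qed

text \<open>The quotient of the two sides without the factor 2 is
  \<open>2 (L!)^2 / ((L - k)! (L + k)!)\<close>, and
  \<open>L! / (L - k)! \<le> L^k \<le> (L + k)! / L!\<close>. The bound does not grow with
  \<open>L\<close>; it compares the Lagrange weight at the node 0 with that at the
  \<open>k\<close>-th square.\<close>

lemma prod_square_quotient_le:
  assumes "1 \<le> k" "k \<le> L"
  shows "(\<Prod>i\<in>{1..L}-{k}. real i ^ 2) \<le> 2 * (\<Prod>i\<in>{1..L}-{k}. \<bar>real k ^ 2 - real i ^ 2\<bar>)"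
proof -
  have prod_fact: "(\<Prod>i\<in>{1..L}-{k}. real i) * k = fact L"
    using assms by (simp add: fact_prod prod.remove[of _ k] mult.commute)
  have minus: "(\<Prod>i\<in>{1..L}-{k}. \<bar>real k - real i\<bar>) = fact (k - 1) * fact (L - k)"
  proof -
    have "{1..L}-{k} = {1..<k} \<union> {k<..L}" using assms by auto
    then have "(\<Prod>i\<in>{1..L}-{k}. \<bar>real k - real i\<bar>)
        = (\<Prod>i\<in>{1..<k}. \<bar>real k - real i\<bar>) * (\<Prod>i\<in>{k<..L}. \<bar>real k - real i\<bar>)"
      by (metis (no_types, lifting) prod.union_disjoint finite_atLeastLessThan finite_greaterThanAtMost
          greaterThanAtMost_iff atLeastLessThan_iff disjoint_iff less_asym)
    also have "(\<Prod>i\<in>{1..<k}. \<bar>real k - real i\<bar>) = (\<Prod>i\<in>{1..k-1}. real i)"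
      using assms by (intro prod.reindex_bij_witness[of _ "\<lambda>i. k - i" "\<lambda>i. k - i"]) auto
    also have "(\<Prod>i\<in>{k<..L}. \<bar>real k - real i\<bar>) = (\<Prod>i\<in>{1..L-k}. real i)"
      using assms by (intro prod.reindex_bij_witness[of _ "\<lambda>i. k + i" "\<lambda>i. i - k"]) auto
    finally show ?thesis by (simp add: fact_prod)
  qed
  have plus: "(\<Prod>i\<in>{1..L}-{k}. real k + real i) * (2 * k) * fact k = fact (L + k)"
  proof -
    have "(\<Prod>i\<in>{1..L}-{k}. real k + real i) * (2 * k) = (\<Prod>i\<in>{1..L}. real k + real i)"
      using assms by (subst (2) prod.remove[of _ k]) auto
    also have "\<dots> = (\<Prod>i\<in>{k<..L+k}. real i)"
      by (intro prod.reindex_bij_witness[of _ "\<lambda>i. i - k" "\<lambda>i. k + i"]) auto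
    also have "\<dots> * fact k = (\<Prod>i\<in>{1..k} \<union> {k<..L+k}. real i)"
      by (subst prod.union_disjoint) (auto simp: fact_prod)
    also have "{1..k} \<union> {k<..L+k} = {1..L+k}" by auto
    finally show ?thesis by (simp add: fact_prod)
  qed
  have "(fact L)\<^sup>2 \<le> (fact (L + k) * fact (L - k) :: nat)"
  proof -
    have "fact L div fact (L - k) \<le> (fact (L + k) div fact L :: nat)"
    proof -
      have "fact L div fact (L - k) \<le> L ^ k"
        using assms by (intro fact_div_fact_le_pow) auto
      also have "L ^ k \<le> (\<Prod>i\<in>{L+1..L+k}. i)"
      proof -
        have "(\<Prod>i\<in>{L+1..L+k}. L) \<le> (\<Prod>i\<in>{L+1..L+k}. i)"
          by (intro prod_mono) auto
        then show ?thesis by simp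
      qed
      also have "\<dots> = fact (L + k) div fact L"
        by (subst fact_div_fact) auto
      finally show ?thesis .
    qed
    moreover have "(fact (L - k) :: nat) dvd fact L" "(fact L :: nat) dvd fact (L + k)"
      by (auto intro: fact_dvd)
    ultimately have dvd: "fact (L - k) * (fact L div fact (L - k)) = (fact L :: nat)"
        "fact L * (fact (L + k) div fact L) = (fact (L + k) :: nat)"
        and le: "fact L div fact (L - k) \<le> (fact (L + k) div fact L :: nat)"
      by auto
    have "(fact L)\<^sup>2 = fact L * (fact (L - k) * (fact L div fact (L - k)) :: nat)"
      by (simp add: dvd(1) power2_eq_square)
    also have "\<dots> \<le> fact L * (fact (L - k) * (fact (L + k) div fact L))"
      by (intro mult_le_mono le) auto
    also have "\<dots> = fact (L + k) * fact (L - k)"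
      by (metis dvd(2) mult.assoc mult.commute)
    finally show ?thesis .
  qed
  then have fact_le: "(fact L)\<^sup>2 \<le> (fact (L + k) * fact (L - k) :: real)"
    by (metis of_nat_fact of_nat_le_iff of_nat_mult of_nat_power)
  define P where "P = (\<Prod>i\<in>{1..L}-{k}. real i)"
  define Q where "Q = (\<Prod>i\<in>{1..L}-{k}. real k + real i)"
  have kpos: "real k > 0" using assms by simp
  have "fact k = real k * fact (k - 1)" using assms by (simp add: fact_reduce)
  then have Q: "fact (L + k) = Q * (2 * k) * (real k * fact (k - 1))"
    using plus by (simp add: Q_def)
  have "(P * k)\<^sup>2 \<le> Q * (2 * k) * (real k * fact (k - 1)) * fact (L - k)"
    using fact_le prod_fact Q by (simp add: P_def)
  also have "\<dots> = (2 * (fact (k - 1) * fact (L - k) * Q)) * (real k)\<^sup>2"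
    by (simp add: power2_eq_square)
  finally have "P\<^sup>2 \<le> 2 * (fact (k - 1) * fact (L - k) * Q)"
    using kpos by (simp add: power_mult_distrib)
  also have "fact (k - 1) * fact (L - k) * Q = (\<Prod>i\<in>{1..L}-{k}. \<bar>real k ^ 2 - real i ^ 2\<bar>)"
    unfolding Q_def minus[symmetric] prod.distrib[symmetric]
  proof (intro prod.cong refl)
    fix i
    have "real k ^ 2 - real i ^ 2 = (real k - real i) * (real k + real i)"
      by (simp add: power2_eq_square algebra_simps)
    then show "\<bar>real k - real i\<bar> * (real k + real i) = \<bar>real k ^ 2 - real i ^ 2\<bar>"
      by (simp add: abs_mult)
  qed
  finally show ?thesis by (simp add: P_def prod_power_distrib)
qed

lemma sum_inverse_squares_le: "(\<Sum>k=1..L. 1 / (real k)\<^sup>2) \<le> 2"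
proof -
  have "(\<Sum>k=1..Suc L. 1 / (real k)\<^sup>2) \<le> 2 - 1 / real (Suc L)" for L
  proof (induction L)
    case (Suc L)
    have "1 / (real (Suc (Suc L)))\<^sup>2 \<le> 1 / real (Suc L) - 1 / real (Suc (Suc L))"
      by (simp add: divide_simps power2_eq_square)
    with Suc show ?case by simp
  qed auto
  from this[of "L - 1"] show ?thesis
    by (cases L) (auto elim!: order.trans simp del: sum.cl_ivl_Suc of_nat_Suc)
qed

lemma obtain_finite_pmf:
  fixes p :: "'i \<Rightarrow> real" and x :: "'i \<Rightarrow> 'a"
  assumes fin: "finite J" and nonneg: "\<And>j. j \<in> J \<Longrightarrow> 0 \<le> p j" and sum1: "(\<Sum>j\<in>J. p j) = 1"
  obtains P where "set_pmf P \<subseteq> x ` J"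
    and "\<And>f :: 'a \<Rightarrow> real. measure_pmf.expectation P f = (\<Sum>j\<in>J. p j * f (x j))"
    and "\<And>A. measure_pmf.prob P A = (\<Sum>j\<in>J. p j * of_bool (x j \<in> A))"
proof -
  define w where "w j = (if j \<in> J then p j else 0)" for j
  define I where "I = embed_pmf w"
  have pmf_I: "pmf I j = w j" for j
    unfolding I_def
  proof (rule pmf_embed_pmf)
    show "0 \<le> w j" for j using nonneg by (simp add: w_def)
    have "(\<integral>\<^sup>+ j. ennreal (w j) \<partial>count_space UNIV) = (\<Sum>j\<in>J. ennreal (w j))"
      using fin by (intro nn_integral_count_space') (auto simp: w_def)
    also have "\<dots> = ennreal (\<Sum>j\<in>J. p j)"
      using nonneg by (subst sum_ennreal) (auto simp: w_def)
    finally show "(\<integral>\<^sup>+ j. ennreal (w j) \<partial>count_space UNIV) = 1"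
      by (simp add: sum1)
  qed
  have I_sub: "set_pmf I \<subseteq> J" by (auto simp: set_pmf_eq pmf_I w_def)
  show ?thesis
  proof (rule that[of "map_pmf x I"])
    show "set_pmf (map_pmf x I) \<subseteq> x ` J" using I_sub by auto
    show E: "measure_pmf.expectation (map_pmf x I) f = (\<Sum>j\<in>J. p j * f (x j))" for f :: "'a \<Rightarrow> real"
      using I_sub fin
      by (simp, subst integral_measure_pmf_real[where A = J]) (auto simp: pmf_I w_def mult.commute)
    fix A
    have "measure_pmf.prob (map_pmf x I) A = measure_pmf.expectation (map_pmf x I) (indicator A)"
      by simp
    then show "measure_pmf.prob (map_pmf x I) A = (\<Sum>j\<in>J. p j * of_bool (x j \<in> A))"
      unfolding E by (simp add: indicator_def)
  qed
qed

text \<open>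
  The nodes are \<open>0\<close>, \<open>1\<close>, \<open>a\<close> and the dilated squares \<open>16 a k\<^sup>2\<close>. Their Lagrange weights alternate in
  sign; the even-indexed nodes carry \<open>U\<close> and the odd-indexed ones carry \<open>V\<close>. The node \<open>a\<close> makes the
  weight at \<open>16 a k\<^sup>2\<close> decay like \<open>k\<^sup>-\<^sup>4\<close>, so that the squares contribute little even to the mean.
\<close>
lemma obtain_moment_matching_pmfs:
  fixes a :: real and L :: nat
  assumes a: "2 \<le> a"
  obtains U V :: "real pmf" where
    "finite (set_pmf U)" "finite (set_pmf V)"
    "set_pmf U \<subseteq> {0} \<union> {a..16 * a * (real L)\<^sup>2 + a}" "set_pmf V \<subseteq> {1..16 * a * (real L)\<^sup>2 + a}"
    "\<And>l. l \<le> L \<Longrightarrow> measure_pmf.expectation U (\<lambda>x. x ^ l) = measure_pmf.expectation V (\<lambda>x. x ^ l)"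
    "measure_pmf.prob U {x. x \<noteq> 0} \<le> 2 / a" "measure_pmf.prob U {a} \<ge> 1 / (2 * a)"
    "measure_pmf.prob V {x. x \<noteq> 1} \<le> 1 / 100" "measure_pmf.expectation V (\<lambda>x. x) \<le> 4 / 3"
proof -
  define c where "c = 16 * a"
  define x where "x j = (if j = 0 then 0 else if j = 1 then 1 else if j = 2 then a
                         else c * (real (j - 2))\<^sup>2)" for j :: nat
  have x_simps [simp]: "x 0 = 0" "x (Suc 0) = 1" "x 2 = a" "x 1 = 1" by (simp_all add: x_def)
  have x_sq: "x (k + 2) = c * (real k)\<^sup>2" if "1 \<le> k" for k using that by (simp add: x_def)
  have c: "c \<ge> 32" using a by (simp add: c_def)
  have ck: "c * (real k)\<^sup>2 \<ge> c" if "1 \<le> k" for k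
    using that c by simp
  have mono: "strict_mono x"
  proof (rule strict_monoI_Suc)
    fix j :: nat
    consider "j = 0" | "j = 1" | "j = 2" | "j > 2" by linarith
    then show "x j < x (Suc j)"
    proof cases
      case 4
      then have "real (j - 2) < real (Suc j - 2)" by simp
      then have "(real (j - 2))\<^sup>2 < (real (Suc j - 2))\<^sup>2" by (intro power_strict_mono) auto
      then show ?thesis using 4 c by (simp add: x_def)
    qed (use a in \<open>auto simp: x_def c_def numeral_2_eq_2\<close>)
  qed
  have x_less: "x i < x j \<longleftrightarrow> i < j" for i j
    using mono by (simp add: strict_mono_less)
  have x_le: "x i \<le> x j \<longleftrightarrow> i \<le> j" for i j
    using mono by (simp add: strict_mono_less_eq)

  \<comment> \<open>There are \<open>L + 3\<close> nodes, so moments of order below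
    \<open>L + 2\<close> agree. Order 0 gives both halves the same total mass \<open>Z\<close>;
    order 1 later determines the mass at \<open>a\<close>.\<close>
  define N where "N = L + 2"
  define v where "v j = 1 / (\<Prod>i\<in>{..N}-{j}. \<bar>x j - x i\<bar>)" for j
  have v_pos: "v j > 0" for j
    unfolding v_def using mono by (auto intro!: prod_pos simp: strict_mono_eq)
  define Ev where "Ev = {j. j \<le> N \<and> even j}"
  define Od where "Od = {j. j \<le> N \<and> odd j}"
  have fin: "finite Ev" "finite Od" by (auto simp: Ev_def Od_def)
  have match: "(\<Sum>j\<in>Ev. v j * x j ^ l) = (\<Sum>j\<in>Od. v j * x j ^ l)" if "l < N" for l
  proof -
    have "{..N} = Ev \<union> Od" "Ev \<inter> Od = {}" by (auto simp: Ev_def Od_def)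
    then have "(\<Sum>j\<le>N. (-1) ^ j * x j ^ l / (\<Prod>i\<in>{..N}-{j}. \<bar>x j - x i\<bar>))
       = (\<Sum>j\<in>Ev. (-1) ^ j * (v j * x j ^ l)) + (\<Sum>j\<in>Od. (-1) ^ j * (v j * x j ^ l))"
      using fin by (simp add: sum.union_disjoint v_def)
    also have "(\<Sum>j\<in>Ev. (-1) ^ j * (v j * x j ^ l)) = (\<Sum>j\<in>Ev. v j * x j ^ l)"
      by (intro sum.cong) (auto simp: Ev_def)
    also have "(\<Sum>j\<in>Od. (-1) ^ j * (v j * x j ^ l)) = - (\<Sum>j\<in>Od. v j * x j ^ l)"
      unfolding sum_negf[symmetric] by (intro sum.cong) (auto simp: Od_def)
    finally show ?thesis
      using alternating_lagrange_weights_annihilate[OF monotone_on_subset[OF mono subset_UNIV] that]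
      by simp
  qed
  define Z where "Z = (\<Sum>j\<in>Ev. v j)"
  have Z_odd: "Z = (\<Sum>j\<in>Od. v j)" using match[of 0] by (simp add: Z_def N_def)
  have v0_le: "v 0 \<le> Z"
    unfolding Z_def using v_pos by (intro member_le_sum) (auto simp: Ev_def less_imp_le)
  have Z: "Z > 0" using v0_le v_pos[of 0] by linarith
  define p where "p j = v j / Z" for j
  have p_pos: "p j > 0" for j using v_pos Z by (simp add: p_def)
  have sum_p: "(\<Sum>j\<in>Ev. p j) = 1" "(\<Sum>j\<in>Od. p j) = 1"
    using Z by (simp_all add: p_def sum_divide_distrib[symmetric] Z_odd[symmetric])
       (simp add: Z_def[symmetric])
  have p_match: "(\<Sum>j\<in>Ev. p j * x j ^ l) = (\<Sum>j\<in>Od. p j * x j ^ l)" if "l < N" for l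
    using match[OF that] by (simp add: p_def sum_divide_distrib[symmetric])

  \<comment> \<open>As \<open>v 0 \<le> Z\<close>, it suffices to compare with the node 0. The nodes
    1 and \<open>a\<close> contribute \<open>(y - 1) (y - a)\<close> here but only \<open>a\<close>
    at 0, and the other squares change the quotient by a factor of at most 2, so
    \<open>v (k + 2) / v 0\<close> is at most about \<open>2 a / y^2\<close>. With
    \<open>y = 16 a k^2\<close> the exact constant is 64/465, below 1/7.\<close>
  have tail: "p (k + 2) * x (k + 2) \<le> 1 / (7 * (real k)\<^sup>2)" if k: "1 \<le> k" "k \<le> L" for k
  proof -
    define y where "y = c * (real k)\<^sup>2"
    define A where "A = (\<Prod>i\<in>{1..L}-{k}. c * (real i)\<^sup>2)"
    define B where "B = (\<Prod>i\<in>{1..L}-{k}. c * \<bar>(real k)\<^sup>2 - (real i)\<^sup>2\<bar>)"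
    have y: "y \<ge> c" "y = 16 * a * (real k)\<^sup>2" using ck k by (auto simp: y_def c_def)
    have "A > 0" unfolding A_def using c by (intro prod_pos) auto
    have "A \<le> 2 * B"
      unfolding A_def B_def prod.distrib
      using mult_left_mono[OF prod_square_quotient_le[OF k], of "\<Prod>i\<in>{1..L}-{k}. c"] c by simp
    then have "B > 0" using \<open>A > 0\<close> by simp
    have set0: "{..N} - {0} = {1, 2} \<union> (\<lambda>i. i + 2) ` {1..L}"
    proof (intro equalityI subsetI)
      fix i assume "i \<in> {..N} - {0}"
      then show "i \<in> {1, 2} \<union> (\<lambda>i. i + 2) ` {1..L}"
        by (cases "i \<le> 2") (auto simp: N_def image_iff intro!: bexI[of _ "i - 2"])
    qed (auto simp: N_def)
    have setk: "{..N} - {k + 2} = {0, 1, 2} \<union> (\<lambda>i. i + 2) ` ({1..L} - {k})"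
    proof (intro equalityI subsetI)
      fix i assume "i \<in> {..N} - {k + 2}"
      then show "i \<in> {0, 1, 2} \<union> (\<lambda>i. i + 2) ` ({1..L} - {k})"
        by (cases "i \<le> 2") (auto simp: N_def image_iff intro!: bexI[of _ "i - 2"])
    qed (use k in \<open>auto simp: N_def\<close>)
    have "(\<Prod>i\<in>{..N}-{0}. \<bar>x 0 - x i\<bar>) = a * (\<Prod>i\<in>{1..L}. \<bar>x (i + 2)\<bar>)"
      unfolding set0 using a
      by (subst prod.union_disjoint) (auto simp: prod.reindex inj_on_def)
    also have "(\<Prod>i\<in>{1..L}. \<bar>x (i + 2)\<bar>) = (\<Prod>i\<in>{1..L}. c * (real i)\<^sup>2)"
      using c by (intro prod.cong) (auto simp: x_def)
    also have "\<dots> = y * A"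
      using k by (subst prod.remove[of _ k]) (auto simp: y_def A_def)
    finally have v0: "v 0 = 1 / (a * (y * A))" by (simp add: v_def)
    have "(\<Prod>i\<in>{..N}-{k+2}. \<bar>x (k+2) - x i\<bar>)
        = y * (y - 1) * (y - a) * (\<Prod>i\<in>{1..L}-{k}. \<bar>x (k + 2) - x (i + 2)\<bar>)"
    proof -
      have xk: "x (k + 2) = y" using x_sq k by (simp add: y_def)
      have "(\<Prod>i\<in>{0, 1, 2}. \<bar>y - x i\<bar>) = y * (y - 1) * (y - a)"
        using y(1) c a by (simp add: c_def)
      then show ?thesis
        unfolding setk xk by (subst prod.union_disjoint) (auto simp: prod.reindex inj_on_def)
    qed
    also have "(\<Prod>i\<in>{1..L}-{k}. \<bar>x (k + 2) - x (i + 2)\<bar>) = B"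
      unfolding B_def
    proof (intro prod.cong refl)
      fix i assume "i \<in> {1..L} - {k}"
      then have "x (k + 2) - x (i + 2) = c * ((real k)\<^sup>2 - (real i)\<^sup>2)"
        using k by (simp add: x_def algebra_simps)
      then show "\<bar>x (k + 2) - x (i + 2)\<bar> = c * \<bar>(real k)\<^sup>2 - (real i)\<^sup>2\<bar>"
        using c by (simp add: abs_mult)
    qed
    finally have vk: "v (k + 2) = 1 / (y * (y - 1) * (y - a) * B)" by (simp add: v_def)
    have y32: "y \<ge> 32" using y c by simp
    have ya: "y - a \<ge> 15 / 16 * y" using y a c unfolding c_def by simp
    have y1: "y - 1 \<ge> 31 / 32 * y" using y32 by simp
    have "v (k + 2) * y = 1 / ((y - 1) * (y - a) * B)"
      unfolding vk using y32 by simp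
    also have "\<dots> \<le> 1 / ((31 / 32 * y) * (15 / 16 * y) * (A / 2))"
      using y32 ya y1 \<open>A > 0\<close> \<open>A \<le> 2 * B\<close> \<open>B > 0\<close>
      by (intro divide_left_mono mult_mono mult_pos_pos) auto
    also have "\<dots> = 1024 / 465 * (a / y) * v 0"
      using y32 \<open>A > 0\<close> a by (simp add: v0 divide_simps)
    also have "\<dots> = 64 / (465 * (real k)\<^sup>2) * v 0"
      using a k by (simp add: y(2) divide_simps)
    also have "\<dots> \<le> 1 / (7 * (real k)\<^sup>2) * v 0"
      using v_pos[of 0] k by (intro mult_right_mono) (auto simp: divide_simps)
    also have "\<dots> \<le> 1 / (7 * (real k)\<^sup>2) * Z"
      using v0_le by (intro mult_left_mono) auto
    finally have "v (k + 2) * y / Z \<le> 1 / (7 * (real k)\<^sup>2)"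
      using Z by (simp add: pos_divide_le_eq)
    moreover have "p (k + 2) * x (k + 2) = v (k + 2) * y / Z"
      unfolding p_def x_sq[OF k(1)] y_def by simp
    ultimately show ?thesis by simp
  qed
  have px_nonneg: "0 \<le> p j * x j" for j
    using p_pos[of j] x_le[of 0 j] by simp
  define S where "S P = (\<Sum>k\<in>{k\<in>{1..L}. P k}. p (k + 2) * x (k + 2))" for P :: "nat \<Rightarrow> bool"
  have S_le: "S P \<le> 2 / 7" for P
  proof -
    have "S P \<le> (\<Sum>k\<in>{1..L}. p (k + 2) * x (k + 2))"
      unfolding S_def using px_nonneg by (intro sum_mono2) auto
    also have "\<dots> \<le> (\<Sum>k\<in>{1..L}. 1 / 7 * (1 / (real k)\<^sup>2))"
      using tail by (intro sum_mono) (auto simp del: add_2_eq_Suc')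
    also have "\<dots> \<le> 1 / 7 * 2"
      unfolding sum_distrib_left[symmetric] by (intro mult_left_mono sum_inverse_squares_le) auto
    finally show ?thesis by simp
  qed
  \<comment> \<open>Markov's inequality: the squares are all at least \<open>c\<close>. As
    \<open>c \<ge> 32\<close>, a contribution of 2/7 to the mean means mass below 1/100.\<close>
  have p_tail: "(\<Sum>k\<in>{k\<in>{1..L}. P k}. p (k + 2)) \<le> S P / c" for P
    unfolding S_def sum_divide_distrib
  proof (intro sum_mono)
    fix k assume "k \<in> {k\<in>{1..L}. P k}"
    then have "x (k + 2) \<ge> c" using ck[of k] x_sq[of k] by auto
    then have "p (k + 2) * c \<le> p (k + 2) * x (k + 2)"
      using p_pos[of "k + 2"] by (intro mult_left_mono) auto
    then show "p (k + 2) \<le> p (k + 2) * x (k + 2) / c"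
      using c by (simp add: field_simps)
  qed
  have Ev_eq: "Ev = {0, 2} \<union> (\<lambda>i. i + 2) ` {k\<in>{1..L}. even k}"
  proof (intro equalityI subsetI)
    fix i assume "i \<in> Ev"
    then have i: "i \<le> L + 2" "even i" by (auto simp: Ev_def N_def)
    show "i \<in> {0, 2} \<union> (\<lambda>i. i + 2) ` {k\<in>{1..L}. even k}"
    proof (cases "2 < i")
      case True
      then have "i = (i - 2) + 2" "i - 2 \<in> {k\<in>{1..L}. even k}" using i by auto
      then show ?thesis by blast
    next
      case False
      then have "i = 0 \<or> i = 1 \<or> i = 2" by linarith
      then show ?thesis using i by auto
    qed
  qed (auto simp: N_def Ev_def)
  have Od_eq: "Od = {1} \<union> (\<lambda>i. i + 2) ` {k\<in>{1..L}. odd k}"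
  proof (intro equalityI subsetI)
    fix i assume "i \<in> Od"
    then have i: "i \<le> L + 2" "odd i" by (auto simp: Od_def N_def)
    show "i \<in> {1} \<union> (\<lambda>i. i + 2) ` {k\<in>{1..L}. odd k}"
    proof (cases "2 < i")
      case True
      then have "i = (i - 2) + 2" "i - 2 \<in> {k\<in>{1..L}. odd k}" using i by auto
      then show ?thesis by blast
    next
      case False
      then have "i = 0 \<or> i = 1 \<or> i = 2" by linarith
      then show ?thesis using i by auto
    qed
  qed (auto simp: N_def Od_def)
  have sum_Ev: "(\<Sum>j\<in>Ev. f j) = f 0 + f 2 + (\<Sum>k\<in>{k\<in>{1..L}. even k}. f (k + 2))" for f :: "nat \<Rightarrow> real"
    unfolding Ev_eq by (subst sum.union_disjoint) (auto simp: sum.reindex inj_on_def)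
  have sum_Od: "(\<Sum>j\<in>Od. f j) = f 1 + (\<Sum>k\<in>{k\<in>{1..L}. odd k}. f (k + 2))" for f :: "nat \<Rightarrow> real"
    unfolding Od_eq by (subst sum.union_disjoint) (auto simp: sum.reindex inj_on_def)

  have tail_small: "S P / c \<le> 1 / 100" for P
    using S_le[of P] c by (simp add: divide_simps)
  have p1: "p 1 \<ge> 99 / 100" "p 1 \<le> 1"
  proof -
    have "(\<Sum>k\<in>{k\<in>{1..L}. odd k}. p (k + 2)) \<ge> 0"
      using p_pos by (intro sum_nonneg) (auto simp: less_imp_le)
    then show "p 1 \<ge> 99 / 100" "p 1 \<le> 1"
      using sum_p(2) p_tail[of odd] tail_small[of odd] unfolding sum_Od by linarith+
  qed
  \<comment> \<open>Equality of the first moments. Nearly all mass of the odd half sits at the node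
    1, so the even half needs mass of order \<open>1 / a\<close> at the node \<open>a\<close>. This
    fixes both the density and the total weight of the sparse law.\<close>
  have mean: "a * p 2 + S even = p 1 + S odd"
    using p_match[of 1] unfolding sum_Ev sum_Od by (simp add: S_def N_def mult.commute)
  have S_nonneg: "S P \<ge> 0" for P
    unfolding S_def using px_nonneg by (intro sum_nonneg) auto
  have p2: "a * p 2 \<ge> 1 / 2" "a * p 2 \<le> 9 / 7"
    using mean p1 S_le[of even] S_le[of odd] S_nonneg[of odd] S_nonneg[of even] by linarith+

  obtain U where U: "set_pmf U \<subseteq> x ` Ev"
      "\<And>f :: real \<Rightarrow> real. measure_pmf.expectation U f = (\<Sum>j\<in>Ev. p j * f (x j))"
      "\<And>A. measure_pmf.prob U A = (\<Sum>j\<in>Ev. p j * of_bool (x j \<in> A))"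
    using obtain_finite_pmf[of Ev p x] fin p_pos sum_p by (auto simp: less_imp_le)
  obtain V where V: "set_pmf V \<subseteq> x ` Od"
      "\<And>f :: real \<Rightarrow> real. measure_pmf.expectation V f = (\<Sum>j\<in>Od. p j * f (x j))"
      "\<And>A. measure_pmf.prob V A = (\<Sum>j\<in>Od. p j * of_bool (x j \<in> A))"
    using obtain_finite_pmf[of Od p x] fin p_pos sum_p by (auto simp: less_imp_le)
  have x_upper: "x j \<le> 16 * a * (real L)\<^sup>2 + a" if "j \<le> N" for j
  proof -
    have "x j \<le> x N" using that x_le by simp
    also have "\<dots> \<le> 16 * a * (real L)\<^sup>2 + a"
      using a by (simp add: x_def N_def c_def)
    finally show ?thesis .
  qed
  have x_lower: "x j \<ge> a" if "2 \<le> j" for j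
    using x_le[of 2 j] that by simp
  show ?thesis
  proof (rule that[of U V])
    show "finite (set_pmf U)" "finite (set_pmf V)"
      using U(1) V(1) fin finite_subset by blast+
    show "set_pmf U \<subseteq> {0} \<union> {a..16 * a * (real L)\<^sup>2 + a}"
    proof
      fix y assume "y \<in> set_pmf U"
      then obtain j where j: "j \<in> Ev" "y = x j" using U(1) by auto
      then have "j = 0 \<or> 2 \<le> j" by (auto simp: Ev_def elim: evenE)
      then show "y \<in> {0} \<union> {a..16 * a * (real L)\<^sup>2 + a}"
        using j x_upper x_lower by (auto simp: Ev_def)
    qed
    show "set_pmf V \<subseteq> {1..16 * a * (real L)\<^sup>2 + a}"
    proof
      fix y assume "y \<in> set_pmf V"
      then obtain j where j: "j \<in> Od" "y = x j" using V(1) by auto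
      then have "j \<ge> 1" by (auto simp: Od_def elim: oddE)
      then show "y \<in> {1..16 * a * (real L)\<^sup>2 + a}"
        using j x_upper x_le[of 1 j] by (auto simp: Od_def)
    qed
    show "measure_pmf.expectation U (\<lambda>x. x ^ l) = measure_pmf.expectation V (\<lambda>x. x ^ l)"
      if "l \<le> L" for l
      using p_match[of l] that by (simp add: U(2) V(2) N_def)
    have "measure_pmf.prob U {x. x \<noteq> 0} = p 2 + (\<Sum>k\<in>{k\<in>{1..L}. even k}. p (k + 2))"
    proof -
      have "x (k + 2) \<noteq> 0" for k using x_less[of 0 "k + 2"] by auto
      then show ?thesis unfolding U(3) sum_Ev using a by simp
    qed
    also have "\<dots> \<le> (9 / 7) / a + (2 / 7) / c"
    proof (intro add_mono)
      show "p 2 \<le> (9 / 7) / a" using p2 a by (simp add: field_simps)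
      show "(\<Sum>k\<in>{k\<in>{1..L}. even k}. p (k + 2)) \<le> (2 / 7) / c"
        using p_tail[of even] divide_right_mono[OF S_le[of even], of c] c by linarith
    qed
    also have "\<dots> \<le> 2 / a" using a by (simp add: c_def field_simps)
    finally show "measure_pmf.prob U {x. x \<noteq> 0} \<le> 2 / a" .
    have "p 2 \<le> measure_pmf.prob U {a}"
      unfolding U(3) sum_Ev using a p_pos by (auto intro!: sum_nonneg simp: less_imp_le)
    moreover have "p 2 \<ge> 1 / (2 * a)" using p2 a by (simp add: field_simps)
    ultimately show "measure_pmf.prob U {a} \<ge> 1 / (2 * a)" by linarith
    have "measure_pmf.prob V {x. x \<noteq> 1} = (\<Sum>k\<in>{k\<in>{1..L}. odd k}. p (k + 2) * of_bool (x (k + 2) \<noteq> 1))"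
      unfolding V(3) sum_Od by simp
    also have "\<dots> \<le> (\<Sum>k\<in>{k\<in>{1..L}. odd k}. p (k + 2))"
      using p_pos by (intro sum_mono) (auto simp: less_imp_le)
    also have "\<dots> \<le> 1 / 100" using p_tail[of odd] tail_small[of odd] by linarith
    finally show "measure_pmf.prob V {x. x \<noteq> 1} \<le> 1 / 100" .
    have "measure_pmf.expectation V (\<lambda>x. x) = p 1 + S odd"
      unfolding V(2) sum_Od S_def by simp
    also have "\<dots> \<le> 4 / 3" using p1 S_le[of odd] by linarith
    finally show "measure_pmf.expectation V (\<lambda>x. x) \<le> 4 / 3" .
  qed
qed

section \<open>Thinned sampling\<close>

fun iid_expectation :: "'e set \<Rightarrow> ('e \<Rightarrow> real) \<Rightarrow> nat \<Rightarrow> ('e list \<Rightarrow> real) \<Rightarrow> real" where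
  "iid_expectation E p 0 \<phi> = \<phi> []"
| "iid_expectation E p (Suc m) \<phi> = (\<Sum>e\<in>E. p e * iid_expectation E p m (\<lambda>l. \<phi> (e # l)))"

text \<open>
  Expected value of \<open>\<phi>\<close> on the first \<open>m\<close> successes of \<open>R\<close> independent trials, where a trial yields \<open>e\<close>
  with probability \<open>p e\<close> and fails with the remaining probability; the value counts as \<open>0\<close> if there
  are fewer than \<open>m\<close> successes. This plays the role of Poissonization: unlike the law of \<open>m\<close> samples
  from the normalised weights, it is polynomial in every single weight.
\<close>
fun thinned_expectation :: "'e set \<Rightarrow> ('e \<Rightarrow> real) \<Rightarrow> nat \<Rightarrow> nat \<Rightarrow> ('e list \<Rightarrow> real) \<Rightarrow> real" where
  "thinned_expectation E p R 0 \<phi> = \<phi> []"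
| "thinned_expectation E p 0 (Suc m) \<phi> = 0"
| "thinned_expectation E p (Suc R) (Suc m) \<phi> =
     (\<Sum>e\<in>E. p e * thinned_expectation E p R m (\<lambda>l. \<phi> (e # l)))
     + (1 - sum p E) * thinned_expectation E p R (Suc m) \<phi>"

text \<open>The probability of at least \<open>m\<close> successes in \<open>R\<close> trials of
  success rate \<open>w\<close>, by conditioning on the first trial.\<close>

fun binomial_tail :: "real \<Rightarrow> nat \<Rightarrow> nat \<Rightarrow> real" where
  "binomial_tail w R 0 = 1"
| "binomial_tail w 0 (Suc m) = 0"
| "binomial_tail w (Suc R) (Suc m) = w * binomial_tail w R m + (1 - w) * binomial_tail w R (Suc m)"

lemma trial_success_induct [case_names 1 2 3]:
  assumes "\<And>R. P R 0" "\<And>m. P 0 (Suc m)" "\<And>R m. P R m \<Longrightarrow> P R (Suc m) \<Longrightarrow> P (Suc R) (Suc m)"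
  shows "P (R :: nat) (m :: nat)"
proof (induction R arbitrary: m)
  case 0
  show ?case using assms by (cases m) auto
next
  case (Suc R)
  then show ?case using assms by (cases m) auto
qed

text \<open>Given that there are enough successes, the first \<open>m\<close> of them are i.i.d.
  with the normalised weights, so the two factors separate.\<close>

lemma thinned_expectation_eq:
  assumes "sum p E = w" "w \<noteq> 0"
  shows "thinned_expectation E p R m \<phi> = binomial_tail w R m * iid_expectation E (\<lambda>e. p e / w) m \<phi>"
proof (induction R m arbitrary: \<phi> rule: trial_success_induct)
  case (3 R m)
  have "thinned_expectation E p (Suc R) (Suc m) \<phi> =
      (\<Sum>e\<in>E. p e * (binomial_tail w R m * iid_expectation E (\<lambda>e. p e / w) m (\<lambda>l. \<phi> (e # l))))
      + (1 - w) * (binomial_tail w R (Suc m) * iid_expectation E (\<lambda>e. p e / w) (Suc m) \<phi>)"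
    using 3 assms(1) by simp
  also have "(\<Sum>e\<in>E. p e * (binomial_tail w R m * iid_expectation E (\<lambda>e. p e / w) m (\<lambda>l. \<phi> (e # l))))
      = w * binomial_tail w R m * iid_expectation E (\<lambda>e. p e / w) (Suc m) \<phi>"
    using assms(2) by (simp add: sum_distrib_left mult_ac)
  finally show ?case by (simp add: algebra_simps)
qed auto

lemma binomial_tail_bounds:
  assumes "0 \<le> w" "w \<le> 1"
  shows "0 \<le> binomial_tail w R m \<and> binomial_tail w R m \<le> 1"
proof (induction R m rule: trial_success_induct)
  case (3 R m)
  then show ?case
    using assms convex_bound_le[of "binomial_tail w R m" 1 "binomial_tail w R (Suc m)" w "1 - w"] by simp
qed auto

text \<open>Chernoff's bound with the exponential moment \<open>2\<^sup>-\<^sup>X\<close>.\<close>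
lemma binomial_tail_ge:
  assumes "0 \<le> w" "w \<le> 1"
  shows "1 - 2 ^ m * (1 - w / 2) ^ R \<le> binomial_tail w R m"
proof (induction R m rule: trial_success_induct)
  case (3 R m)
  \<comment> \<open>The lower bound satisfies the recursion of \<open>binomial_tail\<close> with
    equality, since \<open>w / 2 + (1 - w) = 1 - w / 2\<close>.\<close>
  have "1 - 2 ^ Suc m * (1 - w / 2) ^ Suc R =
      w * (1 - 2 ^ m * (1 - w / 2) ^ R) + (1 - w) * (1 - 2 ^ Suc m * (1 - w / 2) ^ R)"
    by (simp add: algebra_simps)
  also have "\<dots> \<le> w * binomial_tail w R m + (1 - w) * binomial_tail w R (Suc m)"
    using 3 assms by (intro add_mono mult_left_mono) auto
  finally show ?case by simp
next
  case (2 m)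
  have "(1::real) \<le> 2 ^ Suc m" by (rule one_le_power) simp
  then show ?case by simp
qed (use assms in auto)

lemma thinned_expectation_bounds:
  assumes "\<And>e. e \<in> E \<Longrightarrow> 0 \<le> p e" "sum p E \<le> 1" "\<And>l. 0 \<le> \<phi> l \<and> \<phi> l \<le> 1"
  shows "0 \<le> thinned_expectation E p R m \<phi> \<and> thinned_expectation E p R m \<phi> \<le> 1"
  using assms(3)
proof (induction R m arbitrary: \<phi> rule: trial_success_induct)
  case (3 R m)
  have IH: "0 \<le> thinned_expectation E p R m (\<lambda>l. \<phi> (e # l))
        \<and> thinned_expectation E p R m (\<lambda>l. \<phi> (e # l)) \<le> 1" for e
    by (rule 3(1)) (rule 3(3))
  have IH': "0 \<le> thinned_expectation E p R (Suc m) \<phi> \<and> thinned_expectation E p R (Suc m) \<phi> \<le> 1"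
    by (rule 3(2)) (rule 3(3))
  have "(\<Sum>e\<in>E. p e * thinned_expectation E p R m (\<lambda>l. \<phi> (e # l))) \<le> (\<Sum>e\<in>E. p e * 1)"
    using IH assms(1) by (intro sum_mono mult_left_mono) auto
  moreover have "(1 - sum p E) * thinned_expectation E p R (Suc m) \<phi> \<le> (1 - sum p E) * 1"
    using IH' assms(2) by (intro mult_left_mono) auto
  moreover have "0 \<le> (\<Sum>e\<in>E. p e * thinned_expectation E p R m (\<lambda>l. \<phi> (e # l)))"
    using IH assms(1) by (intro sum_nonneg) auto
  moreover have "0 \<le> (1 - sum p E) * thinned_expectation E p R (Suc m) \<phi>"
    using IH' assms(2) by simp
  ultimately show ?case by simp
qed auto

text \<open>One trial is affine in \<open>t\<close>: the weight enters as the probability of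
  \<open>e\<close> and, negatively, in the probability \<open>1 - s - t\<close> of failure. The
  constant part \<open>C\<close> is a convex combination of the previous polynomials, and the linear
  part is a difference of two of them. This gives the coefficients of \<open>(1 + 2 t)^R\<close> as
  bounds, by Pascal's rule. They depend neither on the other weights nor on
  \<open>m\<close>.\<close>

lemma thinned_expectation_polynomial:
  assumes fin: "finite E" and e: "e \<in> E"
    and p: "\<And>e'. e' \<in> E - {e} \<Longrightarrow> 0 \<le> p e'" "sum p (E - {e}) \<le> 1"
    and \<phi>: "\<And>l. \<bar>\<phi> l\<bar> \<le> 1"
  shows "\<exists>c. (\<forall>j. \<bar>coeff c j\<bar> \<le> real (R choose j) * 2 ^ j) \<and>
             (\<forall>t. thinned_expectation E (p(e := t)) R m \<phi> = poly c t)"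
  using \<phi>
proof (induction R m arbitrary: \<phi> rule: trial_success_induct)
  case (1 R)
  have "\<bar>coeff [:\<phi> []:] j\<bar> \<le> real (R choose j) * 2 ^ j" for j
    using 1[of "[]"] by (cases j) auto
  then show ?case by (intro exI[of _ "[:\<phi> []:]"]) auto
next
  case (2 m)
  show ?case by (intro exI[of _ 0]) auto
next
  case (3 R m)
  define s where "s = sum p (E - {e})"
  have "\<forall>e'. \<exists>c. (\<forall>j. \<bar>coeff c j\<bar> \<le> real (R choose j) * 2 ^ j) \<and>
             (\<forall>t. thinned_expectation E (p(e := t)) R m (\<lambda>l. \<phi> (e' # l)) = poly c t)"
    by (intro allI 3(1)) (rule 3(3))
  then obtain A where A: "\<And>e' j. \<bar>coeff (A e') j\<bar> \<le> real (R choose j) * 2 ^ j"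
      "\<And>e' t. thinned_expectation E (p(e := t)) R m (\<lambda>l. \<phi> (e' # l)) = poly (A e') t"
    by metis
  obtain B where B: "\<And>j. \<bar>coeff B j\<bar> \<le> real (R choose j) * 2 ^ j"
      "\<And>t. thinned_expectation E (p(e := t)) R (Suc m) \<phi> = poly B t"
    using 3(2)[of \<phi>] 3(3) by blast
  define C where "C = (\<Sum>e'\<in>E-{e}. smult (p e') (A e')) + smult (1 - s) B"
  define c where "c = C + pCons 0 (A e - B)"
  have C: "\<bar>coeff C j\<bar> \<le> real (R choose j) * 2 ^ j" for j
  proof -
    have "\<bar>coeff C j\<bar> \<le> \<bar>\<Sum>e'\<in>E-{e}. p e' * coeff (A e') j\<bar> + \<bar>(1 - s) * coeff B j\<bar>"
      unfolding C_def by (simp add: coeff_sum)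
    also have "\<dots> \<le> (\<Sum>e'\<in>E-{e}. p e' * (real (R choose j) * 2 ^ j)) + (1 - s) * (real (R choose j) * 2 ^ j)"
    proof (intro add_mono)
      show "\<bar>\<Sum>e'\<in>E-{e}. p e' * coeff (A e') j\<bar> \<le> (\<Sum>e'\<in>E-{e}. p e' * (real (R choose j) * 2 ^ j))"
        using p(1) A(1)
        by (intro order.trans[OF sum_abs] sum_mono) (auto simp: abs_mult intro!: mult_left_mono)
      show "\<bar>(1 - s) * coeff B j\<bar> \<le> (1 - s) * (real (R choose j) * 2 ^ j)"
        using p(2) B(1)[of j] by (auto simp: abs_mult s_def intro!: mult_left_mono)
    qed
    also have "\<dots> = real (R choose j) * 2 ^ j"
      by (simp add: sum_distrib_right[symmetric] s_def[symmetric] algebra_simps)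
    finally show ?thesis .
  qed
  have "\<bar>coeff c j\<bar> \<le> real (Suc R choose j) * 2 ^ j" for j
  proof (cases j)
    case 0
    then show ?thesis using C[of 0] by (simp add: c_def)
  next
    case (Suc i)
    have "\<bar>coeff c j\<bar> \<le> \<bar>coeff C j\<bar> + (\<bar>coeff (A e) i\<bar> + \<bar>coeff B i\<bar>)"
      by (simp add: c_def Suc)
    also have "\<dots> \<le> real (R choose j) * 2 ^ j + (real (R choose i) * 2 ^ i + real (R choose i) * 2 ^ i)"
      by (intro add_mono C A B)
    also have "\<dots> = real (Suc R choose j) * 2 ^ j"
      by (simp add: Suc algebra_simps)
    finally show ?thesis .
  qed
  moreover have "thinned_expectation E (p(e := t)) (Suc R) (Suc m) \<phi> = poly c t" for t
  proof -
    have "sum (p(e := t)) E = t + s"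
      using fin e by (subst sum.remove[of _ e]) (auto simp: s_def intro!: sum.cong)
    moreover have "(\<Sum>e'\<in>E. (p(e := t)) e' * poly (A e') t) = t * poly (A e) t + (\<Sum>e'\<in>E-{e}. p e' * poly (A e') t)"
      using fin e by (subst sum.remove[of _ e]) (auto intro!: sum.cong)
    ultimately show ?thesis
      by (simp del: fun_upd_apply add: A(2) B(2) c_def C_def poly_sum algebra_simps)
  qed
  ultimately show ?case by blast
qed

section \<open>Exchanging one weight law for the other\<close>

text \<open>Terms of degree up to \<open>L\<close> cancel. For the others both moments lie between 0
  and \<open>M ^ j\<close>, so their difference is at most \<open>M ^ j\<close>.\<close>

lemma matching_moments_poly_diff:
  fixes U V :: "real pmf"
  assumes fin: "finite (set_pmf U)" "finite (set_pmf V)"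
    and range: "set_pmf U \<subseteq> {0..M}" "set_pmf V \<subseteq> {0..M}"
    and moments: "\<And>l. l \<le> L \<Longrightarrow> measure_pmf.expectation U (\<lambda>x. x ^ l) = measure_pmf.expectation V (\<lambda>x. x ^ l)"
    and c: "\<And>j. \<bar>coeff c j\<bar> \<le> b j" "\<And>j. R < j \<Longrightarrow> b j = 0" and T: "T > 0"
  shows "\<bar>measure_pmf.expectation U (\<lambda>t. poly c (t / T)) - measure_pmf.expectation V (\<lambda>t. poly c (t / T))\<bar>
       \<le> (\<Sum>j\<in>{L<..R}. b j * (M / T) ^ j)"
proof -
  have "degree c \<le> R"
    using c by (intro degree_le) (metis abs_le_zero_iff)
  then have poly_eq: "poly c (t / T) = (\<Sum>j\<le>R. coeff c j / T ^ j * t ^ j)" for t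
  proof -
    have "poly c (t / T) = (\<Sum>j\<le>R. coeff c j * (t / T) ^ j)"
      unfolding poly_altdef using \<open>degree c \<le> R\<close>
      by (intro sum.mono_neutral_left) (auto simp: coeff_eq_0)
    then show ?thesis by (simp add: power_divide)
  qed
  have E_eq: "measure_pmf.expectation P (\<lambda>t. poly c (t / T))
      = (\<Sum>j\<le>R. coeff c j / T ^ j * measure_pmf.expectation P (\<lambda>t. t ^ j))"
    if "finite (set_pmf P)" for P
    unfolding poly_eq
    by (subst Bochner_Integration.integral_sum) (auto intro!: integrable_measure_pmf_finite that)
  define d where "d j = measure_pmf.expectation U (\<lambda>t. t ^ j) - measure_pmf.expectation V (\<lambda>t. t ^ j)" for j
  have moment_bounds: "0 \<le> measure_pmf.expectation P (\<lambda>t. t ^ j) \<and> measure_pmf.expectation P (\<lambda>t. t ^ j) \<le> M ^ j"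
    if "finite (set_pmf P)" "set_pmf P \<subseteq> {0..M}" for P :: "real pmf" and j
  proof
    show "0 \<le> measure_pmf.expectation P (\<lambda>t. t ^ j)"
      using that(2) by (intro integral_nonneg_AE) (auto simp: AE_measure_pmf_iff)
    have "measure_pmf.expectation P (\<lambda>t. t ^ j) \<le> measure_pmf.expectation P (\<lambda>t. M ^ j)"
      using that by (intro integral_mono_AE integrable_measure_pmf_finite)
         (auto simp: AE_measure_pmf_iff intro!: power_mono)
    then show "measure_pmf.expectation P (\<lambda>t. t ^ j) \<le> M ^ j" by simp
  qed
  have d: "\<bar>d j\<bar> \<le> M ^ j" for j
    using moment_bounds[OF fin(1) range(1), of j] moment_bounds[OF fin(2) range(2), of j]
    unfolding d_def by linarith
  have "measure_pmf.expectation U (\<lambda>t. poly c (t / T)) - measure_pmf.expectation V (\<lambda>t. poly c (t / T))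
      = (\<Sum>j\<le>R. coeff c j / T ^ j * d j)"
    by (simp add: E_eq fin d_def sum_subtractf[symmetric] right_diff_distrib)
  also have "\<dots> = (\<Sum>j\<in>{L<..R}. coeff c j / T ^ j * d j)"
    using moments by (intro sum.mono_neutral_right) (auto simp: d_def not_less)
  also have "\<bar>\<dots>\<bar> \<le> (\<Sum>j\<in>{L<..R}. b j * (M / T) ^ j)"
  proof (intro order.trans[OF sum_abs] sum_mono)
    fix j
    have "\<bar>coeff c j / T ^ j * d j\<bar> = \<bar>coeff c j\<bar> * \<bar>d j\<bar> / T ^ j"
      using T by (simp add: abs_mult)
    also have "\<dots> \<le> b j * M ^ j / T ^ j"
      using T c(1)[of j] d[of j] by (intro divide_right_mono mult_mono) auto
    finally show "\<bar>coeff c j / T ^ j * d j\<bar> \<le> b j * (M / T) ^ j"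
      by (simp add: power_divide)
  qed
  finally show ?thesis .
qed

text \<open>The error is exponentially small in \<open>L\<close> although \<open>R\<close> may
  exceed \<open>k\<close> by a factor \<open>L / 32\<close>: the term of degree \<open>j\<close> is
  at most \<open>(L / 16)^j / j!\<close>, and \<open>L^j / j! \<le> exp L \<le> 3^j\<close> for
  \<open>j > L\<close>, which leaves a geometric series of ratio 3/16.\<close>

lemma binomial_tail_series_le:
  assumes "2 * real R \<le> real k * (real L / 16)" "k > 0"
  shows "(\<Sum>j\<in>{L<..R}. (real (R choose j) * 2 ^ j) * (1 / real k) ^ j) \<le> (1 / 4) ^ L"
proof -
  have term_le: "(real (R choose j) * 2 ^ j) * (1 / real k) ^ j \<le> (3 / 16) ^ j" if "j \<in> {L<..R}" for j
  proof -
    have "real (R choose j) * fact j \<le> real R ^ j"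
      using binomial_fact_pow[of R j] by (metis of_nat_fact of_nat_le_iff of_nat_mult of_nat_power)
    then have "real (R choose j) \<le> real R ^ j / fact j"
      by (simp add: field_simps)
    then have "(real (R choose j) * 2 ^ j) * (1 / real k) ^ j \<le> (real R ^ j / fact j * 2 ^ j) * (1 / real k) ^ j"
      by (intro mult_right_mono) auto
    also have "\<dots> = (2 * real R / real k) ^ j / fact j"
      by (simp add: power_mult_distrib power_divide mult.commute)
    also have "\<dots> \<le> (real L / 16) ^ j / fact j"
      using assms by (intro divide_right_mono power_mono) (auto simp: field_simps)
    also have "\<dots> = (1 / 16) ^ j * (real L ^ j / fact j)"
      by (simp add: power_divide)
    also have "real L ^ j / fact j \<le> exp (real L)"
    proof -
      have "(\<Sum>i\<in>{j}. real L ^ i /\<^sub>R fact i) \<le> (\<Sum>i. real L ^ i /\<^sub>R fact i)"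
        by (intro sum_le_suminf summable_exp_generic) auto
      then show ?thesis by (simp add: exp_def divide_inverse mult.commute)
    qed
    also have "exp (real L) = exp 1 ^ L" by (simp add: exp_of_nat_mult[of L 1, simplified])
    also have "\<dots> \<le> 3 ^ L" by (intro power_mono exp_le) auto
    also have "(3 :: real) ^ L \<le> 3 ^ j" using that by (intro power_increasing) auto
    finally have "(real (R choose j) * 2 ^ j) * (1 / real k) ^ j \<le> (1 / 16) ^ j * 3 ^ j"
      by simp
    then show ?thesis by (simp add: power_mult_distrib[symmetric])
  qed
  have "(\<Sum>j\<in>{L<..R}. (real (R choose j) * 2 ^ j) * (1 / real k) ^ j) \<le> (\<Sum>j\<in>{L<..R}. (3 / 16) ^ j)"
    by (intro sum_mono term_le)
  also have "\<dots> \<le> (1 / 4) ^ L"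
  proof (cases "L \<le> R")
    case True
    have "(\<Sum>j\<in>{L<..R}. (3 / 16 :: real) ^ j) = (\<Sum>j=Suc L..R. (3 / 16) ^ j)"
      by (intro sum.cong) auto
    also have "\<dots> = ((3 / 16) ^ Suc L - (3 / 16) ^ Suc R) / (1 - 3 / 16)"
      using True by (cases "L = R") (auto simp: sum_gp)
    also have "\<dots> \<le> (3 / 16) ^ Suc L / (1 - 3 / 16)"
      by (intro divide_right_mono) auto
    also have "\<dots> \<le> (3 / 16) ^ L" by simp
    also have "\<dots> \<le> (1 / 4) ^ L" by (intro power_mono) auto
    finally show ?thesis .
  qed auto
  finally show ?thesis .
qed

lemma finite_set_Pi_pmf:
  assumes "finite A" "\<And>x. x \<in> A \<Longrightarrow> finite (set_pmf (p x))"
  shows "finite (set_pmf (Pi_pmf A d p))"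
  using assms by (simp add: set_Pi_pmf finite_PiE_dflt)

lemma expectation_Pi_pmf_insert:
  fixes F :: "('a \<Rightarrow> 'b) \<Rightarrow> real"
  assumes A: "finite A" "e \<notin> A" and fin: "\<And>x. x \<in> insert e A \<Longrightarrow> finite (set_pmf (p x))"
  shows "measure_pmf.expectation (Pi_pmf (insert e A) d p) F =
         measure_pmf.expectation (Pi_pmf A d p) (\<lambda>f. measure_pmf.expectation (p e) (\<lambda>y. F (f(e := y))))"
proof -
  have finA: "finite (set_pmf (Pi_pmf A d p))"
    using A fin by (intro finite_set_Pi_pmf) auto
  have "Pi_pmf (insert e A) d p = do {f \<leftarrow> Pi_pmf A d p; y \<leftarrow> p e; return_pmf (f(e := y))}"
    unfolding Pi_pmf_insert'[OF A] by (rule bind_commute_pmf)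
  also have "\<dots> = do {f \<leftarrow> Pi_pmf A d p; map_pmf (\<lambda>y. f(e := y)) (p e)}"
    by (simp add: map_pmf_def)
  also have "measure_pmf.expectation \<dots> F =
      (\<Sum>f\<in>set_pmf (Pi_pmf A d p). pmf (Pi_pmf A d p) f *\<^sub>R measure_pmf.expectation (map_pmf (\<lambda>y. f(e := y)) (p e)) F)"
    using finA fin by (intro pmf_expectation_bind) auto
  also have "\<dots> = measure_pmf.expectation (Pi_pmf A d p) (\<lambda>f. measure_pmf.expectation (p e) (\<lambda>y. F (f(e := y))))"
    by (subst integral_measure_pmf[OF finA]) auto
  finally show ?thesis .
qed

text \<open>The coordinates are exchanged one at a time.\<close>
lemma expectation_Pi_pmf_exchange:
  fixes U V :: "'b pmf" and F :: "('a \<Rightarrow> 'b) \<Rightarrow> real"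
  assumes fin: "finite E" "finite (set_pmf U)" "finite (set_pmf V)"
    and step: "\<And>e f. e \<in> E \<Longrightarrow> (\<And>e'. e' \<in> E - {e} \<Longrightarrow> f e' \<in> set_pmf U \<union> set_pmf V) \<Longrightarrow>
      \<bar>measure_pmf.expectation U (\<lambda>y. F (f(e := y))) - measure_pmf.expectation V (\<lambda>y. F (f(e := y)))\<bar> \<le> \<delta>"
  shows "\<bar>measure_pmf.expectation (Pi_pmf E d (\<lambda>_. U)) F - measure_pmf.expectation (Pi_pmf E d (\<lambda>_. V)) F\<bar>
           \<le> real (card E) * \<delta>"
proof -
  define P where "P A e = (if e \<in> A then V else U)" for A and e :: 'a
  have finP: "finite (set_pmf (P A e))" for A e using fin by (simp add: P_def)
  have "\<bar>measure_pmf.expectation (Pi_pmf E d (\<lambda>_. U)) F - measure_pmf.expectation (Pi_pmf E d (P A)) F\<bar>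
          \<le> real (card A) * \<delta>" if "finite A" "A \<subseteq> E" for A
    using that
  proof (induction A)
    case empty
    then show ?case by (simp add: P_def)
  next
    case (insert e A)
    define Q where "Q = Pi_pmf (E - {e}) d (P A)"
    have E: "E = insert e (E - {e})" using insert by auto
    have finQ: "finite (set_pmf Q)"
      unfolding Q_def using fin finP by (intro finite_set_Pi_pmf) auto
    have "Pi_pmf (E - {e}) d (P (insert e A)) = Q"
      unfolding Q_def by (intro Pi_pmf_cong) (auto simp: P_def)
    then have new: "measure_pmf.expectation (Pi_pmf E d (P (insert e A))) F
        = measure_pmf.expectation Q (\<lambda>f. measure_pmf.expectation V (\<lambda>y. F (f(e := y))))"
      by (subst E, subst expectation_Pi_pmf_insert) (use fin finP in \<open>auto simp: P_def\<close>)
    have old: "measure_pmf.expectation (Pi_pmf E d (P A)) F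
        = measure_pmf.expectation Q (\<lambda>f. measure_pmf.expectation U (\<lambda>y. F (f(e := y))))"
      by (subst E, subst expectation_Pi_pmf_insert) (use fin finP insert in \<open>auto simp: P_def Q_def\<close>)
    have "\<bar>measure_pmf.expectation (Pi_pmf E d (P A)) F - measure_pmf.expectation (Pi_pmf E d (P (insert e A))) F\<bar>
        = \<bar>measure_pmf.expectation Q (\<lambda>f. measure_pmf.expectation U (\<lambda>y. F (f(e := y)))
             - measure_pmf.expectation V (\<lambda>y. F (f(e := y))))\<bar>"
      unfolding old new
      by (subst Bochner_Integration.integral_diff) (auto intro!: integrable_measure_pmf_finite finQ)
    also have "\<dots> \<le> measure_pmf.expectation Q (\<lambda>f. \<bar>measure_pmf.expectation U (\<lambda>y. F (f(e := y)))
             - measure_pmf.expectation V (\<lambda>y. F (f(e := y)))\<bar>)"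
      by (rule integral_abs_bound)
    also have "\<dots> \<le> measure_pmf.expectation Q (\<lambda>f. \<delta>)"
    proof (intro integral_mono_AE integrable_measure_pmf_finite finQ)
      have "f e' \<in> set_pmf U \<union> set_pmf V" if "f \<in> set_pmf Q" "e' \<in> E - {e}" for f e'
        using that fin set_Pi_pmf_subset'[of "E - {e}" d "P A"]
        by (force simp: Q_def PiE_dflt_def P_def split: if_splits)
      then show "AE f in measure_pmf Q. \<bar>measure_pmf.expectation U (\<lambda>y. F (f(e := y)))
             - measure_pmf.expectation V (\<lambda>y. F (f(e := y)))\<bar> \<le> \<delta>"
        using insert by (intro AE_pmfI step) auto
    qed
    finally have "\<bar>measure_pmf.expectation (Pi_pmf E d (P A)) F - measure_pmf.expectation (Pi_pmf E d (P (insert e A))) F\<bar> \<le> \<delta>"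
      by simp
    moreover have "\<bar>measure_pmf.expectation (Pi_pmf E d (\<lambda>_. U)) F - measure_pmf.expectation (Pi_pmf E d (P A)) F\<bar>
          \<le> real (card A) * \<delta>"
      using insert by auto
    ultimately show ?case
      using insert(1,2) by (simp add: algebra_simps)
  qed
  from this[of E] fin have "\<bar>measure_pmf.expectation (Pi_pmf E d (\<lambda>_. U)) F - measure_pmf.expectation (Pi_pmf E d (P E)) F\<bar>
          \<le> real (card E) * \<delta>" by simp
  moreover have "Pi_pmf E d (P E) = Pi_pmf E d (\<lambda>_. V)"
    by (intro Pi_pmf_cong) (auto simp: P_def)
  ultimately show ?thesis by simp
qed

text \<open>Dividing by the constant \<open>T\<close> keeps the sum of the trial probabilities at
  most 1 for all weights up to \<open>M\<close>, whereas dividing by the actual total would destroy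
  polynomiality. A single weight is at most \<open>M / T\<close>, the reciprocal of
  \<open>card E\<close>, so one exchange costs at most \<open>4 ^ - L\<close>.\<close>

lemma thinned_expectation_moment_matching:
  fixes U V :: "real pmf"
  assumes finE: "finite E" and fin: "finite (set_pmf U)" "finite (set_pmf V)"
    and range: "set_pmf U \<subseteq> {0..M}" "set_pmf V \<subseteq> {0..M}"
    and moments: "\<And>l. l \<le> L \<Longrightarrow> measure_pmf.expectation U (\<lambda>x. x ^ l) = measure_pmf.expectation V (\<lambda>x. x ^ l)"
    and M: "M > 0" and R: "2 * real R \<le> real (card E) * (real L / 16)"
    and \<phi>: "\<And>l. \<bar>\<phi> l\<bar> \<le> 1"
  defines "T \<equiv> real (card E) * M"
  shows "\<bar>measure_pmf.expectation (Pi_pmf E 0 (\<lambda>_. U)) (\<lambda>x. thinned_expectation E (\<lambda>e. x e / T) R m \<phi>)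
        - measure_pmf.expectation (Pi_pmf E 0 (\<lambda>_. V)) (\<lambda>x. thinned_expectation E (\<lambda>e. x e / T) R m \<phi>)\<bar>
         \<le> real (card E) * (1 / 4) ^ L"
proof (cases "E = {}")
  case False
  then have card: "card E > 0" using finE by (simp add: card_gt_0_iff)
  then have T: "T > 0" using M by (simp add: T_def)
  show ?thesis
  proof (rule expectation_Pi_pmf_exchange[OF finE fin])
    fix e f assume e: "e \<in> E" and f: "\<And>e'. e' \<in> E - {e} \<Longrightarrow> f e' \<in> set_pmf U \<union> set_pmf V"
    have fM: "0 \<le> f e' \<and> f e' \<le> M" if "e' \<in> E - {e}" for e'
      using f[OF that] range by auto
    have "(\<Sum>e'\<in>E-{e}. f e' / T) \<le> (\<Sum>e'\<in>E-{e}. M / T)"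
      using fM T by (intro sum_mono divide_right_mono) auto
    also have "\<dots> \<le> 1"
      using finE e M card by (simp add: T_def field_simps)
    finally have "(\<Sum>e'\<in>E-{e}. f e' / T) \<le> 1" .
    moreover have "0 \<le> f e' / T" if "e' \<in> E - {e}" for e'
      using fM[OF that] T by simp
    ultimately obtain c where c: "\<And>j. \<bar>coeff c j\<bar> \<le> real (R choose j) * 2 ^ j"
        "\<And>t. thinned_expectation E ((\<lambda>e. f e / T)(e := t)) R m \<phi> = poly c t"
      using thinned_expectation_polynomial[OF finE e, of "\<lambda>e. f e / T" \<phi> R m] \<phi> by blast
    have upd: "(\<lambda>e'. (f(e := y)) e' / T) = (\<lambda>e. f e / T)(e := y / T)" for y by auto
    have "\<bar>measure_pmf.expectation U (\<lambda>t. poly c (t / T)) - measure_pmf.expectation V (\<lambda>t. poly c (t / T))\<bar>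
       \<le> (\<Sum>j\<in>{L<..R}. (real (R choose j) * 2 ^ j) * (M / T) ^ j)"
      using fin range moments T c(1) by (intro matching_moments_poly_diff) auto
    also have "M / T = 1 / real (card E)" using M by (simp add: T_def)
    also have "(\<Sum>j\<in>{L<..R}. (real (R choose j) * 2 ^ j) * (1 / real (card E)) ^ j) \<le> (1 / 4) ^ L"
      using R card by (rule binomial_tail_series_le)
    finally show "\<bar>measure_pmf.expectation U (\<lambda>y. thinned_expectation E (\<lambda>e'. (f(e := y)) e' / T) R m \<phi>)
        - measure_pmf.expectation V (\<lambda>y. thinned_expectation E (\<lambda>e'. (f(e := y)) e' / T) R m \<phi>)\<bar> \<le> (1 / 4) ^ L"
      unfolding upd c(2) .
  qed
qed simp

section \<open>Runs of the tester as expectations over lists of indices\<close>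

lemma pmf_bind_replicate_eq_iid_expectation:
  assumes "finite E" "set_pmf D \<subseteq> E"
  shows "pmf (bind_pmf (replicate_pmf m D) A) b = iid_expectation E (pmf D) m (\<lambda>l. pmf (A l) b)"
proof (induction m arbitrary: A)
  case 0
  then show ?case by (simp add: bind_return_pmf)
next
  case (Suc m)
  have "pmf (bind_pmf (replicate_pmf (Suc m) D) A) b
      = pmf (bind_pmf D (\<lambda>e. bind_pmf (replicate_pmf m D) (\<lambda>l. A (e # l)))) b"
    by (simp add: bind_assoc_pmf bind_return_pmf)
  also have "\<dots> = (\<Sum>e\<in>E. pmf D e * pmf (bind_pmf (replicate_pmf m D) (\<lambda>l. A (e # l))) b)"
    unfolding pmf_bind[of D] using assms
    by (subst integral_measure_pmf_real[where A = E]) (auto simp: mult.commute)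
  finally show ?case by (simp add: Suc.IH)
qed

lemma replicate_map_pmf: "replicate_pmf m (map_pmf h D) = map_pmf (map h) (replicate_pmf m D)"
  by (induction m) (simp_all add: map_pmf_def bind_assoc_pmf bind_return_pmf)

lemma run_on_samples_cong:
  assumes "\<And>y. y \<in> set_pmf D \<Longrightarrow> f y = g y"
  shows "run_on_samples ALG m D f = run_on_samples ALG m D g"
  unfolding run_on_samples_def
proof (intro bind_pmf_cong refl)
  fix ys assume "ys \<in> set_pmf (replicate_pmf m D)"
  then have "set ys \<subseteq> set_pmf D" by (auto simp: set_replicate_pmf in_lists_conv_set)
  then show "ALG (map (\<lambda>y. (y, f y)) ys) = ALG (map (\<lambda>y. (y, g y)) ys)"
    using assms by (intro arg_cong[of _ _ ALG] map_cong) auto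
qed

lemma pmf_run_on_samples_map:
  assumes "finite E" "set_pmf D \<subseteq> E"
  shows "pmf (run_on_samples ALG m (map_pmf h D) f) b
       = iid_expectation E (pmf D) m (\<lambda>l. pmf (ALG (map (\<lambda>e. (h e, f (h e))) l)) b)"
  unfolding run_on_samples_def replicate_map_pmf bind_map_pmf
  using pmf_bind_replicate_eq_iid_expectation[OF assms, of m "\<lambda>l. ALG (map (\<lambda>e. (h e, f (h e))) l)" b]
  by (simp add: o_def)

section \<open>The hard instances\<close>

definition xnor_label :: "bool list \<Rightarrow> bool" where
  "xnor_label x \<longleftrightarrow> x ! 0 = x ! 1"

text \<open>
  Coordinates \<open>2 + j q + r\<close> with \<open>j < t\<close> and \<open>r < q\<close> carry the complemented one-hot code of the symbol
  \<open>w j g < q\<close>; unused coordinates are \<open>True\<close>.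
\<close>
definition code_point :: "nat \<Rightarrow> nat \<Rightarrow> nat \<Rightarrow> (nat \<Rightarrow> nat \<Rightarrow> nat) \<Rightarrow> nat \<times> bool \<times> bool \<Rightarrow> bool list" where
  "code_point n q t w = (\<lambda>(g, u, v). map (\<lambda>i.
      if i = 0 then u else if i = 1 then v
      else if i < 2 + q * t then w ((i - 2) div q) g \<noteq> (i - 2) mod q
      else True) [0..<n])"

lemma code_point_in_cube: "code_point n q t w e \<in> cube n"
  by (auto simp: code_point_def cube_def split: prod.split)

lemma code_point_nth_0: "2 \<le> n \<Longrightarrow> code_point n q t w (g, u, v) ! 0 = u"
  by (simp add: code_point_def)

lemma code_point_nth_1: "2 \<le> n \<Longrightarrow> code_point n q t w (g, u, v) ! 1 = v"
  by (simp add: code_point_def)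

lemma xnor_label_code_point: "2 \<le> n \<Longrightarrow> xnor_label (code_point n q t w (g, u, v)) \<longleftrightarrow> u = v"
  using code_point_nth_0[of n q t w g u v] code_point_nth_1[of n q t w g u v] by (simp add: xnor_label_def)

lemma code_point_nth_code:
  assumes "2 + q * t \<le> n" "j < t" "r < q"
  shows "2 + j * q + r < n" "code_point n q t w (g, u, v) ! (2 + j * q + r) \<longleftrightarrow> w j g \<noteq> r"
proof -
  have "j * q + r < (j + 1) * q" using assms by simp
  also have "\<dots> \<le> t * q" using assms by (intro mult_right_mono) auto
  finally have less: "j * q + r < q * t" by (simp add: mult.commute)
  then show lt: "2 + j * q + r < n" using assms by linarith
  have "(j * q + r) div q = j" "(j * q + r) mod q = r" using assms by auto
  then show "code_point n q t w (g, u, v) ! (2 + j * q + r) \<longleftrightarrow> w j g \<noteq> r"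
    using lt less by (simp add: code_point_def)
qed

text \<open>The witness is the most restrictive conjunction that accepts all positive points of
  \<open>S\<close>: it uses every coordinate on which they are all true. A negative point of group
  \<open>g\<close> is zero at the coordinate of its symbol \<open>w j g\<close> in block
  \<open>j\<close>; no positive group has that symbol there, so this coordinate belongs to the
  conjunction.\<close>

lemma uncovered_code_points_conjunction:
  assumes n: "2 + q * t \<le> n"
    and w: "\<And>j e. j < t \<Longrightarrow> e \<in> S \<Longrightarrow> w j (fst e) < q"
    and unc: "\<And>g u v. (g, u, v) \<in> S \<Longrightarrow> u \<noteq> v \<Longrightarrow> \<exists>j<t. \<forall>g' b. (g', b, b) \<in> S \<longrightarrow> w j g' \<noteq> w j g"
  shows "\<exists>f. monotone_conjunction n f \<and>
           (\<forall>e\<in>S. f (code_point n q t w e) = xnor_label (code_point n q t w e))"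
proof -
  let ?pt = "code_point n q t w"
  have n2: "2 \<le> n" using n by simp
  define I where "I = {i. i < n \<and> (\<forall>e\<in>S. xnor_label (?pt e) \<longrightarrow> ?pt e ! i)}"
  define f where "f x \<longleftrightarrow> (\<forall>i\<in>I. x ! i)" for x :: "bool list"
  have "monotone_conjunction n f"
    unfolding monotone_conjunction_def f_def by (intro exI[of _ I]) (auto simp: I_def)
  moreover have "f (?pt e) = xnor_label (?pt e)" if e: "e \<in> S" for e
  proof (cases "xnor_label (?pt e)")
    case True
    then show ?thesis using e by (auto simp: f_def I_def)
  next
    case False
    obtain g u v where guv: "e = (g, u, v)" by (cases e)
    with False n2 have "u \<noteq> v" by (simp add: xnor_label_code_point)
    with unc e guv obtain j where j: "j < t" "\<And>g' b. (g', b, b) \<in> S \<Longrightarrow> w j g' \<noteq> w j g" by blast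
    have r: "w j g < q" using w[OF j(1) e] guv by simp
    note nth = code_point_nth_code[OF n j(1) r]
    have "2 + j * q + w j g \<in> I"
      unfolding I_def
    proof (intro CollectI conjI ballI impI)
      fix e' assume e': "e' \<in> S" "xnor_label (?pt e')"
      obtain g' u' v' where "e' = (g', u', v')" by (cases e')
      moreover from this have "u' = v'" using e' n2 by (simp add: xnor_label_code_point)
      ultimately show "?pt e' ! (2 + j * q + w j g)" using e' j(2)[of g' v'] nth(2) by simp
    qed (rule nth(1))
    moreover have "\<not> ?pt e ! (2 + j * q + w j g)" unfolding guv nth(2) by simp
    ultimately show ?thesis using False by (auto simp: f_def)
  qed
  ultimately show ?thesis by blast
qed

text \<open>The four points of a group form a square \<open>a + b = c + d\<close> on which XNOR is not linearly separable.\<close>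
lemma linear_threshold_errs_on_square:
  assumes n: "2 \<le> n" and h: "linear_threshold n h"
  shows "\<exists>u v. xnor_label (code_point n q t w (g, u, v)) \<noteq> h (code_point n q t w (g, u, v))"
proof (rule ccontr)
  assume "\<not> ?thesis"
  then have eq: "h (code_point n q t w (g, u, v)) \<longleftrightarrow> u = v" for u v
    using n by (simp add: xnor_label_code_point)
  obtain W \<theta> where W: "\<And>x. x \<in> cube n \<Longrightarrow> h x \<longleftrightarrow> (\<Sum>i<n. W i * of_bool (x ! i)) \<ge> (\<theta> :: real)"
    using h unfolding linear_threshold_def by blast
  define s where "s u v = (\<Sum>i<n. W i * of_bool (code_point n q t w (g, u, v) ! i))" for u v
  have s_eq: "s u v = W 0 * of_bool u + W 1 * of_bool v + (\<Sum>i=2..<n. W i * of_bool (code_point n q t w (g, True, True) ! i))" for u v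
  proof -
    have "{..<n} = {0, 1} \<union> {2..<n}" using n by auto
    then have "s u v = (\<Sum>i\<in>{0,1}. W i * of_bool (code_point n q t w (g, u, v) ! i))
        + (\<Sum>i=2..<n. W i * of_bool (code_point n q t w (g, u, v) ! i))"
      unfolding s_def by (simp only:) (rule sum.union_disjoint, auto)
    also have "(\<Sum>i=2..<n. W i * of_bool (code_point n q t w (g, u, v) ! i))
        = (\<Sum>i=2..<n. W i * of_bool (code_point n q t w (g, True, True) ! i))"
      by (intro sum.cong) (auto simp: code_point_def)
    also have "(\<Sum>i\<in>{0,1}. W i * of_bool (code_point n q t w (g, u, v) ! i)) = W 0 * of_bool u + W 1 * of_bool v"
    proof -
      have "(\<Sum>i\<in>{0,1}. F i) = F 0 + F 1" for F :: "nat \<Rightarrow> real" by simp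
      then show ?thesis by (simp only: code_point_nth_0[OF n] code_point_nth_1[OF n])
    qed
    finally show ?thesis .
  qed
  have thr: "u = v \<longleftrightarrow> s u v \<ge> \<theta>" for u v
    using W[OF code_point_in_cube, of q t w "(g, u, v)"] eq[of u v] by (simp add: s_def)
  have "s True True \<ge> \<theta>" "s False False \<ge> \<theta>" "s True False < \<theta>" "s False True < \<theta>"
    using thr[of True True] thr[of False False] thr[of True False] thr[of False True] by auto
  then show False unfolding s_eq by simp
qed

lemma normalised_pmf_exists:
  fixes x :: "'e \<Rightarrow> real"
  assumes "finite E" "\<And>e. e \<in> E \<Longrightarrow> 0 \<le> x e" "sum x E > 0"
  shows "\<exists>D. (\<forall>e\<in>E. pmf D e = x e / sum x E) \<and> set_pmf D = {e\<in>E. x e \<noteq> 0}"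
proof -
  have nonneg: "0 \<le> x e / sum x E" if "e \<in> E" for e using that assms by simp
  have sum1: "(\<Sum>e\<in>E. x e / sum x E) = 1" using assms by (simp add: sum_divide_distrib[symmetric])
  show ?thesis
  proof (rule obtain_finite_pmf[OF assms(1) nonneg sum1, where x = id])
    fix D :: "'e pmf"
    assume sub: "set_pmf D \<subseteq> id ` E"
      and prob: "\<And>A. measure_pmf.prob D A = (\<Sum>e\<in>E. (x e / sum x E) * of_bool (id e \<in> A))"
    have pmf: "pmf D e = x e / sum x E" if "e \<in> E" for e
    proof -
      have "pmf D e = measure_pmf.prob D {e}" by (simp add: measure_pmf_single)
      also have "\<dots> = (\<Sum>e'\<in>E. if e' = e then x e' / sum x E else 0)"
        unfolding prob by (intro sum.cong) auto
      finally show ?thesis using that assms(1) by simp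
    qed
    moreover have "set_pmf D = {e\<in>E. x e \<noteq> 0}"
      using sub pmf assms(3) by (auto simp: set_pmf_eq)
    ultimately show ?thesis by blast
  qed
qed

lemma iid_expectation_cong:
  assumes "\<And>e. e \<in> E \<Longrightarrow> p e = p' e"
  shows "iid_expectation E p m \<phi> = iid_expectation E p' m \<phi>"
  using assms by (induction m arbitrary: \<phi>) (auto intro!: sum.cong)

lemma thinned_expectation_eq_run:
  fixes x :: "'e \<Rightarrow> real"
  assumes E: "finite E" and W: "sum x E > 0" and T: "T > 0"
    and D: "\<And>e. e \<in> E \<Longrightarrow> pmf D e = x e / sum x E" "set_pmf D \<subseteq> E"
  shows "thinned_expectation E (\<lambda>e. x e / T) R m (\<lambda>l. pmf (ALG (map (\<lambda>e. (h e, f (h e))) l)) b)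
       = binomial_tail (sum x E / T) R m * pmf (run_on_samples ALG m (map_pmf h D) f) b"
proof -
  have "thinned_expectation E (\<lambda>e. x e / T) R m (\<lambda>l. pmf (ALG (map (\<lambda>e. (h e, f (h e))) l)) b)
      = binomial_tail (sum x E / T) R m * iid_expectation E (\<lambda>e. (x e / T) / (sum x E / T)) m
          (\<lambda>l. pmf (ALG (map (\<lambda>e. (h e, f (h e))) l)) b)"
    using W T by (intro thinned_expectation_eq) (auto simp: sum_divide_distrib[symmetric])
  also have "iid_expectation E (\<lambda>e. (x e / T) / (sum x E / T)) m (\<lambda>l. pmf (ALG (map (\<lambda>e. (h e, f (h e))) l)) b)
      = iid_expectation E (pmf D) m (\<lambda>l. pmf (ALG (map (\<lambda>e. (h e, f (h e))) l)) b)"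
    using T D by (intro iid_expectation_cong) auto
  also have "\<dots> = pmf (run_on_samples ALG m (map_pmf h D) f) b"
    using pmf_run_on_samples_map[OF E D(2)] by simp
  finally show ?thesis .
qed

section \<open>Markov bounds and averaging for product laws\<close>

lemma expectation_sum_Pi_pmf:
  fixes h :: "'b \<Rightarrow> real"
  assumes "finite E" "finite (set_pmf P)"
  shows "measure_pmf.expectation (Pi_pmf E d (\<lambda>_. P)) (\<lambda>x. \<Sum>e\<in>E. h (x e)) = real (card E) * measure_pmf.expectation P h"
proof -
  have fin: "finite (set_pmf (Pi_pmf E d (\<lambda>_. P)))" using assms by (intro finite_set_Pi_pmf)
  have "measure_pmf.expectation (Pi_pmf E d (\<lambda>_. P)) (\<lambda>x. h (x e)) = measure_pmf.expectation P h" if "e \<in> E" for e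
  proof -
    have "measure_pmf.expectation (Pi_pmf E d (\<lambda>_. P)) (\<lambda>x. h (x e))
        = measure_pmf.expectation (map_pmf (\<lambda>x. x e) (Pi_pmf E d (\<lambda>_. P))) h" by simp
    then show ?thesis using assms that by (simp only: Pi_pmf_component if_True)
  qed
  then show ?thesis
    by (subst Bochner_Integration.integral_sum) (auto intro!: integrable_measure_pmf_finite fin)
qed

lemma prob_le_expectation:
  fixes h :: "'a \<Rightarrow> real"
  assumes "finite (set_pmf P)" "c > 0" "\<And>x. x \<in> set_pmf P \<Longrightarrow> 0 \<le> h x"
    and "\<And>x. x \<in> set_pmf P \<Longrightarrow> x \<in> A \<Longrightarrow> c \<le> h x"
  shows "measure_pmf.prob P A \<le> measure_pmf.expectation P h / c"
proof -
  have "measure_pmf.prob P A * c = measure_pmf.expectation P (\<lambda>x. indicator A x * c)" by simp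
  also have "\<dots> \<le> measure_pmf.expectation P h"
    using assms by (intro integral_mono_AE integrable_measure_pmf_finite)
      (auto simp: AE_measure_pmf_iff indicator_def)
  finally show ?thesis using assms by (simp add: field_simps)
qed

lemma set_Pi_pmf_component:
  "x \<in> set_pmf (Pi_pmf E d p) \<Longrightarrow> finite E \<Longrightarrow> e \<in> E \<Longrightarrow> x e \<in> set_pmf (p e)"
  by (auto simp: set_Pi_pmf PiE_dflt_def)

lemma prob_sum_Pi_pmf_ge:
  fixes h :: "'b \<Rightarrow> real"
  assumes "finite E" "finite (set_pmf P)" "\<And>y. y \<in> set_pmf P \<Longrightarrow> 0 \<le> h y" "c > 0"
  shows "measure_pmf.prob (Pi_pmf E d (\<lambda>_. P)) {x. c \<le> (\<Sum>e\<in>E. h (x e))} \<le> real (card E) * measure_pmf.expectation P h / c"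
  unfolding expectation_sum_Pi_pmf[OF assms(1,2), of d, symmetric]
proof (rule prob_le_expectation)
  show "finite (set_pmf (Pi_pmf E d (\<lambda>_. P)))" using assms by (intro finite_set_Pi_pmf)
  show "0 \<le> (\<Sum>e\<in>E. h (x e))" if "x \<in> set_pmf (Pi_pmf E d (\<lambda>_. P))" for x
    using assms(3) set_Pi_pmf_component[OF that assms(1)] by (intro sum_nonneg) auto
qed (use assms in auto)

lemma exists_le_expectation_swap:
  fixes h :: "'a \<Rightarrow> 'b \<Rightarrow> real"
  assumes fin: "finite (set_pmf X)" "finite (set_pmf Y)"
    and le: "\<And>x. x \<in> set_pmf X \<Longrightarrow> measure_pmf.expectation Y (h x) \<le> \<beta>"
  shows "\<exists>y\<in>set_pmf Y. measure_pmf.expectation X (\<lambda>x. h x y) \<le> \<beta>"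
proof (rule ccontr)
  assume "\<not> ?thesis"
  then have gt: "measure_pmf.expectation X (\<lambda>x. h x y) > \<beta>" if "y \<in> set_pmf Y" for y using that by force
  have sumY: "(\<Sum>y\<in>set_pmf Y. pmf Y y) = 1" "(\<Sum>x\<in>set_pmf X. pmf X x) = 1"
    using fin sum_pmf_eq_1[of "set_pmf Y" Y] sum_pmf_eq_1[of "set_pmf X" X] by auto
  have "\<beta> = (\<Sum>y\<in>set_pmf Y. pmf Y y * \<beta>)" using sumY by (simp add: sum_distrib_right[symmetric])
  also have "\<dots> < (\<Sum>y\<in>set_pmf Y. pmf Y y * measure_pmf.expectation X (\<lambda>x. h x y))"
    using gt fin by (intro sum_strict_mono) (auto simp: set_pmf_not_empty pmf_positive)
  also have "\<dots> = (\<Sum>y\<in>set_pmf Y. \<Sum>x\<in>set_pmf X. pmf X x * (pmf Y y * h x y))"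
    using fin by (simp add: integral_measure_pmf[where A = "set_pmf X"] sum_distrib_left mult_ac)
  also have "\<dots> = (\<Sum>x\<in>set_pmf X. pmf X x * measure_pmf.expectation Y (h x))"
    using fin by (subst sum.swap) (simp add: integral_measure_pmf[where A = "set_pmf Y"] sum_distrib_left mult_ac)
  also have "\<dots> \<le> (\<Sum>x\<in>set_pmf X. pmf X x * \<beta>)"
    using le by (intro sum_mono mult_left_mono) auto
  also have "\<dots> = \<beta>" using sumY by (simp add: sum_distrib_right[symmetric])
  finally show False by simp
qed

definition group_elements :: "nat \<Rightarrow> (nat \<times> bool \<times> bool) set" where
  "group_elements K = {..<K} \<times> UNIV"

lemma finite_group_elements [simp]: "finite (group_elements K)"
  by (simp add: group_elements_def)

lemma card_group_elements [simp]: "card (group_elements K) = 4 * K"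
  by (simp add: group_elements_def card_cartesian_product card_UNIV_bool)

text \<open>The label is a function of the point alone, so this test function is the same for all
  weights; only the law of the list \<open>l\<close> varies.\<close>

definition acceptance ::
    "((bool list \<times> bool) list \<Rightarrow> bool pmf) \<Rightarrow> ('e \<Rightarrow> bool list) \<Rightarrow> 'e list \<Rightarrow> real" where
  "acceptance ALG h l = pmf (ALG (map (\<lambda>e. (h e, xnor_label (h e))) l)) True"

lemma acceptance_bounds: "0 \<le> acceptance ALG h l \<and> acceptance ALG h l \<le> 1"
  by (simp add: acceptance_def pmf_le_1)

lemma exp_minus_7_le: "exp (-7 :: real) \<le> 1 / 100"
proof -
  have "(2::real) \<le> exp 1" using exp_ge_add_one_self[of 1] by simp
  then have "(2::real) ^ 7 \<le> exp 1 ^ 7" by (intro power_mono) auto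
  also have "exp 1 ^ 7 = exp (7 :: real)" by (simp flip: exp_of_nat_mult)
  finally show ?thesis by (simp add: exp_minus divide_simps)
qed

section \<open>Spread weights\<close>

text \<open>A threshold function errs on some point \<open>b g\<close> of every group. Fewer than
  \<open>K / 2\<close> points have a weight other than 1, so more than \<open>K / 2\<close> of these
  errors have weight exactly 1. Against a total below \<open>56 K\<close> they have probability
  above 1/112, more than the required 1/250.\<close>

lemma far_from_ltf_code_points:
  fixes x :: "nat \<times> bool \<times> bool \<Rightarrow> real"
  assumes n: "2 \<le> n" and K: "K > 0" and \<epsilon>: "\<epsilon> \<le> 1 / 250"
    and x: "\<And>e. e \<in> group_elements K \<Longrightarrow> 1 \<le> x e"
    and W: "sum x (group_elements K) < 14 * (4 * real K)"
    and bad: "(\<Sum>e\<in>group_elements K. of_bool (x e \<noteq> 1)) < real K / 2"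
    and D: "\<And>e. e \<in> group_elements K \<Longrightarrow> pmf D e = x e / sum x (group_elements K)"
  shows "far_from_ltf n \<epsilon> (map_pmf (code_point n q t w) D) xnor_label"
  unfolding far_from_ltf_def
proof (intro allI impI)
  fix h assume h: "linear_threshold n h"
  define E where "E = group_elements K"
  let ?pt = "code_point n q t w"
  have "\<forall>g. \<exists>b. xnor_label (?pt (g, b)) \<noteq> h (?pt (g, b))"
    using linear_threshold_errs_on_square[OF n h] by (metis)
  then obtain b where b: "\<And>g. xnor_label (?pt (g, b g)) \<noteq> h (?pt (g, b g))" by metis
  define G where "G = {g. g < K \<and> x (g, b g) = 1}"
  have finG: "finite G" by (simp add: G_def)
  have "card ({..<K} - G) \<le> card {e\<in>E. x e \<noteq> 1}"
    by (rule card_inj_on_le[of "\<lambda>g. (g, b g)"]) (auto simp: inj_on_def G_def E_def group_elements_def)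
  also have "real (card {e\<in>E. x e \<noteq> 1}) = (\<Sum>e\<in>E. of_bool (x e \<noteq> 1))"
    by (simp add: E_def Collect_conj_eq)
  finally have "real (card ({..<K} - G)) < real K / 2"
    using bad by (simp add: E_def)
  moreover have "card ({..<K} - G) = K - card G" "card G \<le> K"
  proof -
    have sub: "G \<subseteq> {..<K}" by (auto simp: G_def)
    show "card ({..<K} - G) = K - card G" using card_Diff_subset[OF finG sub] by simp
    show "card G \<le> K" using card_mono[OF _ sub] by simp
  qed
  ultimately have G: "real (card G) > real K / 2" by (simp add: of_nat_diff)
  have Wpos: "sum x E > 0"
    using sum_mono[of E "\<lambda>_. 1" x] x K by (simp add: E_def)
  have "1 / 250 \<le> (real K / 2) / (14 * (4 * real K))" using K by simp
  also have "\<dots> \<le> real (card G) / sum x E"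
    using G W Wpos K by (intro frac_le) (auto simp: E_def)
  also have "\<dots> = (\<Sum>e\<in>(\<lambda>g. (g, b g)) ` G. pmf D e)"
  proof -
    have "(\<Sum>e\<in>(\<lambda>g. (g, b g)) ` G. pmf D e) = (\<Sum>g\<in>G. pmf D (g, b g))"
      by (subst sum.reindex) (auto simp: inj_on_def)
    also have "\<dots> = (\<Sum>g\<in>G. 1 / sum x E)"
      using D by (intro sum.cong) (auto simp: G_def E_def group_elements_def)
    finally show ?thesis by simp
  qed
  also have "\<dots> = measure_pmf.prob D ((\<lambda>g. (g, b g)) ` G)"
    using finG by (simp add: measure_measure_pmf_finite)
  also have "\<dots> \<le> measure_pmf.prob D (?pt -` {x. xnor_label x \<noteq> h x})"
    using b by (intro measure_pmf.finite_measure_mono) auto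
  also have "\<dots> = measure_pmf.prob (map_pmf ?pt D) {x. xnor_label x \<noteq> h x}" by simp
  finally show "\<epsilon> \<le> measure_pmf.prob (map_pmf ?pt D) {x. xnor_label x \<noteq> h x}"
    using \<epsilon> by simp
qed

lemma set_map_code_point_subset: "set_pmf (map_pmf (code_point n q t w) D) \<subseteq> cube n"
  using code_point_in_cube by auto

lemma expectation_of_bool:
  "measure_pmf.expectation P (\<lambda>x. of_bool (Q x) :: real) = measure_pmf.prob P {x. Q x}"
proof -
  have "(\<lambda>x. of_bool (Q x) :: real) = indicator {x. Q x}" by (auto simp: indicator_def)
  then show ?thesis by simp
qed

lemma expectation_le_of_bad_events:
  fixes F :: "'a \<Rightarrow> real"
  assumes "finite (set_pmf P)" "\<And>x. x \<in> set_pmf P \<Longrightarrow> F x \<le> 1" "0 \<le> c"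
    and "\<And>x. x \<in> set_pmf P \<Longrightarrow> x \<notin> A \<Longrightarrow> F x \<le> c"
  shows "measure_pmf.expectation P F \<le> c + measure_pmf.prob P A"
proof -
  have "F x \<le> c + indicator A x" if "x \<in> set_pmf P" for x
    using assms(2)[OF that] assms(3) assms(4)[OF that] by (auto simp: indicator_def)
  then have "measure_pmf.expectation P F \<le> measure_pmf.expectation P (\<lambda>x. c + indicator A x)"
    using assms(1) by (intro integral_mono_AE integrable_measure_pmf_finite AE_pmfI)
  also have "\<dots> = c + measure_pmf.prob P A"
    using assms by (subst Bochner_Integration.integral_add) (auto intro!: integrable_measure_pmf_finite)
  finally show ?thesis .
qed

lemma expectation_ge_of_bad_events:
  fixes F :: "'a \<Rightarrow> real"
  assumes "finite (set_pmf P)" "\<And>x. x \<in> set_pmf P \<Longrightarrow> 0 \<le> F x" "0 \<le> c"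
    and "\<And>x. x \<in> set_pmf P \<Longrightarrow> x \<notin> A \<Longrightarrow> c \<le> F x"
  shows "c * (1 - measure_pmf.prob P A) \<le> measure_pmf.expectation P F"
proof -
  have "c * (1 - measure_pmf.prob P A) = measure_pmf.expectation P (\<lambda>x. c * (1 - indicator A x))"
    using assms
    by (simp, subst Bochner_Integration.integral_diff) (auto intro!: integrable_measure_pmf_finite)
  also have "\<dots> \<le> measure_pmf.expectation P F"
    using assms by (intro integral_mono_AE integrable_measure_pmf_finite)
      (auto simp: AE_measure_pmf_iff indicator_def)
  finally show ?thesis .
qed

text \<open>Outside two bad events the tester accepts with probability at most 1/6, and the thinning
  factor is at most 1. Markov's inequality bounds the bad events by 1/10 and 2/25, and
  \<open>1/6 + 1/10 + 2/25 < 7/20\<close>.\<close>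

lemma acceptance_of_spread_weights:
  fixes V :: "real pmf"
  assumes tester: "conjunction_vs_ltf_tester n \<epsilon> m ALG" and \<epsilon>: "\<epsilon> \<le> 1 / 250" and n: "2 \<le> n" and K: "K > 0"
    and V: "finite (set_pmf V)" "set_pmf V \<subseteq> {1..M}" "measure_pmf.prob V {x. x \<noteq> 1} \<le> 1 / 100"
      "measure_pmf.expectation V (\<lambda>x. x) \<le> 4 / 3"
  defines "E \<equiv> group_elements K"
  defines "T \<equiv> real (card E) * M"
  shows "measure_pmf.expectation (Pi_pmf E 0 (\<lambda>_. V))
     (\<lambda>x. thinned_expectation E (\<lambda>e. x e / T) R m (acceptance ALG (code_point n q t w))) \<le> 7 / 20"
proof -
  let ?X = "Pi_pmf E 0 (\<lambda>_. V)"
  let ?pt = "code_point n q t w"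
  have finE: "finite E" and cardE: "card E = 4 * K" by (simp_all add: E_def)
  have finX: "finite (set_pmf ?X)" using finE V by (intro finite_set_Pi_pmf)
  have range: "1 \<le> x e \<and> x e \<le> M" if "x \<in> set_pmf ?X" "e \<in> E" for x e
    using set_Pi_pmf_component[OF that(1) finE that(2)] V(2) by auto
  have M: "M \<ge> 1" using V(2) set_pmf_not_empty[of V] by force
  have T: "T > 0" using M K by (simp add: T_def cardE)
  \<comment> \<open>Too large a total weight, or too many points of weight other than 1. The factor
    14 makes the first probability at most \<open>(4/3) / 14 < 1/10\<close>.\<close>
  define A where "A = {x. 14 * (4 * real K) \<le> (\<Sum>e\<in>E. x e)}"
  define B where "B = {x. real K / 2 \<le> (\<Sum>e\<in>E. of_bool (x e \<noteq> (1::real)))}"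
  have "measure_pmf.prob ?X A \<le> real (card E) * measure_pmf.expectation V (\<lambda>x. x) / (14 * (4 * real K))"
    unfolding A_def using finE V K by (intro prob_sum_Pi_pmf_ge) auto
  also have "\<dots> \<le> real (card E) * (4 / 3) / (14 * (4 * real K))"
    using V(4) K by (intro divide_right_mono mult_left_mono) auto
  also have "\<dots> \<le> 1 / 10" using K by (simp add: cardE)
  finally have A: "measure_pmf.prob ?X A \<le> 1 / 10" .
  have "measure_pmf.prob ?X B \<le> real (card E) * measure_pmf.expectation V (\<lambda>y. of_bool (y \<noteq> 1)) / (real K / 2)"
    unfolding B_def using finE V K by (intro prob_sum_Pi_pmf_ge) auto
  also have "measure_pmf.expectation V (\<lambda>y. of_bool (y \<noteq> 1)) = measure_pmf.prob V {x. x \<noteq> 1}"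
    by (rule expectation_of_bool)
  also have "real (card E) * measure_pmf.prob V {x. x \<noteq> 1} / (real K / 2) \<le> real (card E) * (1 / 100) / (real K / 2)"
    using V(3) K by (intro divide_right_mono mult_left_mono) auto
  also have "\<dots> \<le> 2 / 25" using K by (simp add: cardE)
  finally have B: "measure_pmf.prob ?X B \<le> 2 / 25" .
  have sumT: "(\<Sum>e\<in>E. x e / T) \<le> 1" if "x \<in> set_pmf ?X" for x
  proof -
    have "(\<Sum>e\<in>E. x e / T) \<le> (\<Sum>e\<in>E. M / T)"
      using range[OF that] T by (intro sum_mono divide_right_mono) auto
    then show ?thesis using M K by (simp add: T_def cardE)
  qed
  have "measure_pmf.expectation ?X (\<lambda>x. thinned_expectation E (\<lambda>e. x e / T) R m (acceptance ALG ?pt))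
      \<le> 1 / 6 + measure_pmf.prob ?X (A \<union> B)"
  proof (rule expectation_le_of_bad_events[OF finX])
    fix x assume x: "x \<in> set_pmf ?X"
    have pos: "0 \<le> x e / T" if "e \<in> E" for e using range[OF x that] T by simp
    show "thinned_expectation E (\<lambda>e. x e / T) R m (acceptance ALG ?pt) \<le> 1"
      using thinned_expectation_bounds[of E "\<lambda>e. x e / T" "acceptance ALG ?pt" R m] pos sumT[OF x]
        acceptance_bounds by blast
    assume AB: "x \<notin> A \<union> B"
    have W: "sum x E > 0"
      using sum_mono[of E "\<lambda>_. 1" x] range[OF x] K by (simp add: cardE)
    have nonneg: "0 \<le> x e" if "e \<in> E" for e using range[OF x that] by simp
    obtain D where D: "\<And>e. e \<in> E \<Longrightarrow> pmf D e = x e / sum x E" "set_pmf D = {e\<in>E. x e \<noteq> 0}"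
      using normalised_pmf_exists[OF finE nonneg W] by blast
    have "far_from_ltf n \<epsilon> (map_pmf ?pt D) xnor_label"
      using AB range[OF x] D by (intro far_from_ltf_code_points[OF n K \<epsilon>, of x]) (auto simp: A_def B_def E_def not_le)
    then have "pmf (run_on_samples ALG m (map_pmf ?pt D) xnor_label) False \<ge> 5 / 6"
      using tester set_map_code_point_subset unfolding conjunction_vs_ltf_tester_def by blast
    then have run: "pmf (run_on_samples ALG m (map_pmf ?pt D) xnor_label) True \<le> 1 / 6"
      by (simp add: pmf_False_conv_True)
    have "thinned_expectation E (\<lambda>e. x e / T) R m (acceptance ALG ?pt)
        = binomial_tail (sum x E / T) R m * pmf (run_on_samples ALG m (map_pmf ?pt D) xnor_label) True"
      unfolding acceptance_def[abs_def] using D by (intro thinned_expectation_eq_run[OF finE W T]) auto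
    also have "\<dots> \<le> 1 * (1 / 6)"
    proof (intro mult_mono run)
      have "sum x E / T \<le> 1" using sumT[OF x] by (simp add: sum_divide_distrib)
      then show "binomial_tail (sum x E / T) R m \<le> 1"
        using binomial_tail_bounds[of "sum x E / T" R m] W T by simp
    qed auto
    finally show "thinned_expectation E (\<lambda>e. x e / T) R m (acceptance ALG ?pt) \<le> 1 / 6" by simp
  qed simp
  also have "measure_pmf.prob ?X (A \<union> B) \<le> measure_pmf.prob ?X A + measure_pmf.prob ?X B"
    by (intro measure_Un_le) auto
  finally show ?thesis using A B by simp
qed

section \<open>Sparse weights\<close>

definition random_column :: "nat \<Rightarrow> nat \<Rightarrow> (nat \<Rightarrow> nat) pmf" where
  "random_column K q = Pi_pmf {..<K} 0 (\<lambda>_. pmf_of_set {..<q})"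

definition random_code :: "nat \<Rightarrow> nat \<Rightarrow> nat \<Rightarrow> (nat \<Rightarrow> nat \<Rightarrow> nat) pmf" where
  "random_code K q t = Pi_pmf {..<t} (\<lambda>_. 0) (\<lambda>_. random_column K q)"

lemma finite_set_random_column: "q > 0 \<Longrightarrow> finite (set_pmf (random_column K q))"
  unfolding random_column_def by (intro finite_set_Pi_pmf) (auto simp: set_pmf_of_set lessThan_empty_iff)

lemma finite_set_random_code: "q > 0 \<Longrightarrow> finite (set_pmf (random_code K q t))"
  unfolding random_code_def by (intro finite_set_Pi_pmf finite_set_random_column) auto

lemma random_code_less:
  assumes "q > 0" "w \<in> set_pmf (random_code K q t)" "j < t" "g < K"
  shows "w j g < q"
proof -
  have "w j \<in> set_pmf (random_column K q)"
    using set_Pi_pmf_component[of w "{..<t}"] assms by (simp add: random_code_def)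
  then have "w j g \<in> set_pmf (pmf_of_set {..<q})"
    using set_Pi_pmf_component[of "w j" "{..<K}"] assms by (simp add: random_column_def)
  then show ?thesis using assms by (simp add: set_pmf_of_set lessThan_empty_iff)
qed

text \<open>The symbol of \<open>g'\<close> may be drawn last; it then has to hit the fixed value
  \<open>c g\<close>.\<close>

lemma prob_random_column_collision:
  assumes q: "q > 0" and g: "g < K" "g' < K" "g' \<noteq> g"
  shows "measure_pmf.prob (random_column K q) {c. c g' = c g} \<le> 1 / real q"
proof -
  let ?P = "\<lambda>_::nat. pmf_of_set {..<q}" and ?A = "{..<K} - {g'}"
  have ins: "{..<K} = insert g' ?A" using g by auto
  have fin: "finite (set_pmf (pmf_of_set {..<q}))" using q by (simp add: set_pmf_of_set lessThan_empty_iff)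
  have finA: "finite (set_pmf (Pi_pmf ?A 0 ?P))" using fin by (intro finite_set_Pi_pmf) auto
  have "measure_pmf.prob (random_column K q) {c. c g' = c g}
      = measure_pmf.expectation (Pi_pmf (insert g' ?A) 0 ?P) (\<lambda>c. of_bool (c g' = c g))"
    unfolding random_column_def ins[symmetric] by (simp only: expectation_of_bool)
  also have "\<dots> = measure_pmf.expectation (Pi_pmf ?A 0 ?P)
      (\<lambda>f. measure_pmf.expectation (pmf_of_set {..<q}) (\<lambda>y. of_bool (y = f g)))"
    using g fin by (subst expectation_Pi_pmf_insert) auto
  also have "\<dots> \<le> measure_pmf.expectation (Pi_pmf ?A 0 ?P) (\<lambda>f. 1 / real q)"
  proof (intro integral_mono_AE integrable_measure_pmf_finite finA AE_pmfI)
    fix f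
    have "measure_pmf.expectation (pmf_of_set {..<q}) (\<lambda>y. of_bool (y = f g)) = pmf (pmf_of_set {..<q}) (f g)"
      unfolding expectation_of_bool by (simp add: measure_pmf_single)
    also have "\<dots> \<le> 1 / real q" using q by (simp add: pmf_of_set lessThan_empty_iff indicator_def)
    finally show "measure_pmf.expectation (pmf_of_set {..<q}) (\<lambda>y. of_bool (y = f g)) \<le> 1 / real q" .
  qed
  finally show ?thesis by simp
qed

lemma prob_UN_le:
  assumes "finite I" "\<And>i. i \<in> I \<Longrightarrow> measure_pmf.prob P (A i) \<le> c"
  shows "measure_pmf.prob P (\<Union>i\<in>I. A i) \<le> real (card I) * c"
proof -
  have "measure_pmf.prob P (\<Union>i\<in>I. A i) \<le> (\<Sum>i\<in>I. measure_pmf.prob P (A i))"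
    using assms by (intro measure_pmf.finite_measure_subadditive_finite) auto
  also have "\<dots> \<le> (\<Sum>i\<in>I. c)" using assms by (intro sum_mono)
  finally show ?thesis by simp
qed

text \<open>For fixed \<open>g\<close>, a union bound over the other groups gives
  \<open>card G / q\<close> in one column, and independence of the columns gives the power
  \<open>t\<close>. A union bound over \<open>g\<close> adds the first factor.\<close>

lemma prob_random_code_covered:
  assumes q: "q > 0" and G: "G \<subseteq> {..<K}"
  shows "measure_pmf.prob (random_code K q t) {w. \<exists>g\<in>G. \<forall>j<t. \<exists>g'\<in>G-{g}. w j g' = w j g}
      \<le> real (card G) * (real (card G) / real q) ^ t"
proof -
  have finG: "finite G" using G finite_subset by blast
  have "measure_pmf.prob (random_code K q t) {w. \<forall>j<t. \<exists>g'\<in>G-{g}. w j g' = w j g} \<le> (real (card G) / real q) ^ t"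
    if g: "g \<in> G" for g
  proof -
    have "measure_pmf.prob (random_column K q) {c. \<exists>g'\<in>G-{g}. c g' = c g}
        = measure_pmf.prob (random_column K q) (\<Union>g'\<in>G-{g}. {c. c g' = c g})"
      by (intro arg_cong[of _ _ "measure_pmf.prob _"]) auto
    also have "\<dots> \<le> real (card (G - {g})) * (1 / real q)"
      using G g q finG by (intro prob_UN_le prob_random_column_collision) auto
    also have "\<dots> \<le> real (card G) * (1 / real q)"
      using finG by (intro mult_right_mono) (auto intro: card_mono)
    finally have col: "measure_pmf.prob (random_column K q) {c. \<exists>g'\<in>G-{g}. c g' = c g} \<le> real (card G) / real q"
      by simp
    define C where "C = {c :: nat \<Rightarrow> nat. \<exists>g'\<in>G-{g}. c g' = c g}"
    have "{w. \<forall>j<t. \<exists>g'\<in>G-{g}. w j g' = w j g} = Pi {..<t} (\<lambda>_. C)"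
      by (auto simp: C_def)
    then have "measure_pmf.prob (random_code K q t) {w. \<forall>j<t. \<exists>g'\<in>G-{g}. w j g' = w j g}
        = measure_pmf.prob (random_code K q t) (Pi {..<t} (\<lambda>_. C))" by simp
    also have "\<dots> = (\<Prod>j<t. measure_pmf.prob (random_column K q) C)"
      unfolding random_code_def by (rule measure_Pi_pmf_Pi) simp
    also have "\<dots> = measure_pmf.prob (random_column K q) C ^ t" by simp
    also have "\<dots> \<le> (real (card G) / real q) ^ t"
      using col by (intro power_mono) (auto simp: C_def)
    finally show ?thesis .
  qed
  then have "measure_pmf.prob (random_code K q t) (\<Union>g\<in>G. {w. \<forall>j<t. \<exists>g'\<in>G-{g}. w j g' = w j g})
      \<le> real (card G) * (real (card G) / real q) ^ t"
    using finG by (intro prob_UN_le)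
  moreover have "(\<Union>g\<in>G. {w. \<forall>j<t. \<exists>g'\<in>G-{g}. w j g' = w j g})
      = {w :: nat \<Rightarrow> nat \<Rightarrow> nat. \<exists>g\<in>G. \<forall>j<t. \<exists>g'\<in>G-{g}. w j g' = w j g}" by auto
  ultimately show ?thesis by simp
qed

definition support :: "nat \<Rightarrow> (nat \<times> bool \<times> bool \<Rightarrow> real) \<Rightarrow> (nat \<times> bool \<times> bool) set" where
  "support K x = {e\<in>group_elements K. x e \<noteq> 0}"

lemma finite_support [simp]: "finite (support K x)"
  by (simp add: support_def)

text \<open>The failure of the cover-free property of superimposed codes: the matching group
  \<open>g'\<close> may change with the column \<open>j\<close>. Labels are ignored, so an uncovered
  set separates each group from all the others.\<close>

definition covered :: "nat \<Rightarrow> (nat \<Rightarrow> nat \<Rightarrow> nat) \<Rightarrow> nat set \<Rightarrow> bool" where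
  "covered t w G \<longleftrightarrow> (\<exists>g\<in>G. \<forall>j<t. \<exists>g'\<in>G-{g}. w j g' = w j g)"

text \<open>A group contributes 16 ordered pairs of points, and the two weights of a pair of
  distinct points are independent. Excluding such pairs matters because points of one group have the
  same code, whatever their labels.\<close>

lemma prob_support_collision:
  assumes p: "measure_pmf.prob U {x. x \<noteq> 0} \<le> p"
  shows "measure_pmf.prob (Pi_pmf (group_elements K) 0 (\<lambda>_. U)) {x. \<not> inj_on fst (support K x)} \<le> real (16 * K) * p ^ 2"
proof -
  define E where "E = group_elements K"
  let ?X = "Pi_pmf E 0 (\<lambda>_. U)"
  have finE: "finite E" by (simp add: E_def)
  define I where "I = {(e, e'). e \<in> E \<and> e' \<in> E \<and> fst e = fst e' \<and> e \<noteq> e'}"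
  have "I \<subseteq> (\<lambda>(g, a, b). ((g, a), (g, b))) ` ({..<K} \<times> (UNIV :: (bool \<times> bool) set) \<times> (UNIV :: (bool \<times> bool) set))"
    by (auto simp: I_def E_def group_elements_def image_iff)
  then have "card I \<le> card ((\<lambda>(g, a, b). ((g, a), (g, b))) ` ({..<K} \<times> (UNIV :: (bool \<times> bool) set) \<times> (UNIV :: (bool \<times> bool) set)))"
    by (intro card_mono finite_imageI) auto
  also have "\<dots> \<le> card ({..<K} \<times> (UNIV :: (bool \<times> bool) set) \<times> (UNIV :: (bool \<times> bool) set))"
    by (intro card_image_le) auto
  also have "\<dots> = 16 * K" by (simp add: card_cartesian_product card_UNIV_bool flip: UNIV_Times_UNIV)
  finally have cardI: "card I \<le> 16 * K" .
  have finI: "finite I" by (rule finite_subset[of _ "E \<times> E"]) (auto simp: I_def finE)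
  have "measure_pmf.prob ?X {x. x (fst i) \<noteq> 0 \<and> x (snd i) \<noteq> 0} \<le> p ^ 2" if in_I: "i \<in> I" for i
  proof -
    obtain e e' where i: "i = (e, e')" "e \<in> E" "e' \<in> E" "e \<noteq> e'" using in_I unfolding I_def by blast
    have "{x. x (fst i) \<noteq> (0::real) \<and> x (snd i) \<noteq> 0} = Pi E (\<lambda>d. if d = e \<or> d = e' then {y. y \<noteq> 0} else UNIV)"
    proof (intro equalityI subsetI)
      fix x :: "nat \<times> bool \<times> bool \<Rightarrow> real"
      assume "x \<in> Pi E (\<lambda>d. if d = e \<or> d = e' then {y. y \<noteq> 0} else UNIV)"
      from PiE[OF this, of e] PiE[OF this, of e'] show "x \<in> {x. x (fst i) \<noteq> 0 \<and> x (snd i) \<noteq> 0}"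
        using i by auto
    qed (use i in auto)
    then have "measure_pmf.prob ?X {x. x (fst i) \<noteq> 0 \<and> x (snd i) \<noteq> 0}
        = (\<Prod>d\<in>E. measure_pmf.prob U (if d = e \<or> d = e' then {y. y \<noteq> 0} else UNIV))"
      by (simp only: measure_Pi_pmf_Pi[OF finE])
    also have "\<dots> = (\<Prod>d\<in>{e, e'}. measure_pmf.prob U {y. y \<noteq> 0})"
      using finE i by (intro prod.mono_neutral_cong_right) auto
    also have "\<dots> = measure_pmf.prob U {y. y \<noteq> 0} ^ 2" using i by (simp add: power2_eq_square)
    also have "\<dots> \<le> p ^ 2" using p by (intro power_mono) auto
    finally show ?thesis .
  qed
  then have "measure_pmf.prob ?X (\<Union>i\<in>I. {x. x (fst i) \<noteq> 0 \<and> x (snd i) \<noteq> 0}) \<le> real (card I) * p ^ 2"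
    using finI by (intro prob_UN_le)
  also have "\<dots> \<le> real (16 * K) * p ^ 2" using cardI by (intro mult_right_mono) (auto simp: of_nat_mono)
  finally have "measure_pmf.prob ?X (\<Union>i\<in>I. {x. x (fst i) \<noteq> 0 \<and> x (snd i) \<noteq> 0}) \<le> real (16 * K) * p ^ 2" .
  moreover have "{x. \<not> inj_on fst (support K x)} \<subseteq> (\<Union>i\<in>I. {x. x (fst i) \<noteq> 0 \<and> x (snd i) \<noteq> 0})"
  proof
    fix x assume "x \<in> {x. \<not> inj_on fst (support K x)}"
    then obtain e e' where "e \<in> support K x" "e' \<in> support K x" "fst e = fst e'" "e \<noteq> e'"
      unfolding inj_on_def by blast
    then show "x \<in> (\<Union>i\<in>I. {x. x (fst i) \<noteq> 0 \<and> x (snd i) \<noteq> 0})"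
      by (intro UN_I[of "(e, e')"]) (simp_all add: I_def support_def E_def)
  qed
  then have "measure_pmf.prob ?X {x. \<not> inj_on fst (support K x)}
      \<le> measure_pmf.prob ?X (\<Union>i\<in>I. {x. x (fst i) \<noteq> 0 \<and> x (snd i) \<noteq> 0})"
    by (intro measure_pmf.finite_measure_mono) auto
  ultimately show ?thesis unfolding E_def by linarith
qed

text \<open>A Chernoff bound that uses only the atom at \<open>a\<close>: as
  \<open>exp (-1) \<le> 1 / 2\<close>, the moment \<open>E exp (- y / a)\<close> is at most
  \<open>1 - 1 / (4 a)\<close>. The threshold \<open>card E / 8\<close> gives back half of the
  resulting exponent \<open>card E / (4 a)\<close>. A total weight above this threshold guarantees
  trials that succeed often enough.\<close>

lemma prob_total_weight_small:
  assumes fin: "finite E" "finite (set_pmf U)" and U: "set_pmf U \<subseteq> {0..}" and a: "a > 0"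
    and p: "measure_pmf.prob U {a} \<ge> 1 / (2 * a)"
  shows "measure_pmf.prob (Pi_pmf E 0 (\<lambda>_. U)) {x. sum x E \<le> real (card E) / 8} \<le> exp (- (real (card E) / (8 * a)))"
proof -
  let ?X = "Pi_pmf E 0 (\<lambda>_. U)"
  have finX: "finite (set_pmf ?X)" using fin by (intro finite_set_Pi_pmf)
  have half: "exp (-1) \<le> (1 / 2 :: real)"
    using exp_ge_add_one_self[of "1::real"] by (simp add: exp_minus divide_simps)
  have "measure_pmf.expectation U (\<lambda>y. exp (- (y / a))) \<le> measure_pmf.expectation U (\<lambda>y. 1 - of_bool (y \<in> {a}) / 2)"
  proof (intro integral_mono_AE integrable_measure_pmf_finite fin AE_pmfI)
    fix y assume "y \<in> set_pmf U"
    then show "exp (- (y / a)) \<le> 1 - of_bool (y \<in> {a}) / 2" using U a half by auto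
  qed
  also have "\<dots> = 1 - measure_pmf.prob U {a} / 2"
    using expectation_of_bool[of U "\<lambda>y. y \<in> {a}"]
    by (subst Bochner_Integration.integral_diff) (auto intro!: integrable_measure_pmf_finite fin)
  also have "\<dots> \<le> 1 + - (1 / (4 * a))" using p a by (simp add: field_simps)
  also have "\<dots> \<le> exp (- (1 / (4 * a)))" by (rule exp_ge_add_one_self)
  finally have single: "measure_pmf.expectation U (\<lambda>y. exp (- (y / a))) \<le> exp (- (1 / (4 * a)))" .
  have "measure_pmf.prob ?X {x. sum x E \<le> real (card E) / 8}
      \<le> measure_pmf.expectation ?X (\<lambda>x. \<Prod>e\<in>E. exp (- (x e / a))) / exp (- (real (card E) / (8 * a)))"
  proof (rule prob_le_expectation[OF finX])
    fix x assume "x \<in> {x. sum x E \<le> real (card E) / 8}"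
    then have "sum x E / a \<le> real (card E) / (8 * a)" using a by (simp add: field_simps)
    moreover have "(\<Prod>e\<in>E. exp (- (x e / a))) = exp (- (sum x E / a))"
      using fin by (simp add: exp_sum[symmetric] sum_negf sum_divide_distrib)
    ultimately show "exp (- (real (card E) / (8 * a))) \<le> (\<Prod>e\<in>E. exp (- (x e / a)))" by simp
  qed (auto intro!: prod_nonneg)
  also have "measure_pmf.expectation ?X (\<lambda>x. \<Prod>e\<in>E. exp (- (x e / a)))
      = (\<Prod>e\<in>E. measure_pmf.expectation U (\<lambda>y. exp (- (y / a))))"
    using fin by (intro expectation_prod_Pi_pmf) (auto intro!: integrable_measure_pmf_finite)
  also have "(\<Prod>e\<in>E. measure_pmf.expectation U (\<lambda>y. exp (- (y / a)))) \<le> (\<Prod>e\<in>E. exp (- (1 / (4 * a))))"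
    by (intro prod_mono conjI single integral_nonneg_AE) auto
  also have "(\<Prod>e\<in>E. exp (- (1 / (4 * a)))) / exp (- (real (card E) / (8 * a)))
      = exp (- (real (card E) / (8 * a)))"
    using a by (simp add: exp_of_nat_mult[symmetric] exp_diff[symmetric] field_simps)
  finally show ?thesis by (simp add: divide_right_mono)
qed

text \<open>For each fixed support of size at most \<open>q / 4\<close> a random code fails with
  probability at most \<open>(q / 4) * 4 ^ - t \<le> 1 / 100\<close>. Averaging over the weights
  then yields one code that works for most supports. A fixed code is needed because the exchange of
  laws concerns the weights alone, with the points unchanged.\<close>

lemma exists_uncovering_code:
  fixes U :: "real pmf"
  assumes fin: "finite (set_pmf U)" and q: "q > 0" and qt: "25 * real q \<le> 4 ^ t"
  shows "\<exists>w\<in>set_pmf (random_code K q t). measure_pmf.prob (Pi_pmf (group_elements K) 0 (\<lambda>_. U))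
     {x. real (card (support K x)) \<le> real q / 4 \<and> covered t w (fst ` support K x)} \<le> 1 / 100"
proof -
  let ?X = "Pi_pmf (group_elements K) 0 (\<lambda>_. U)"
  have finX: "finite (set_pmf ?X)" using fin by (intro finite_set_Pi_pmf) auto
  have "\<exists>w\<in>set_pmf (random_code K q t). measure_pmf.expectation ?X
     (\<lambda>x. of_bool (real (card (support K x)) \<le> real q / 4 \<and> covered t w (fst ` support K x))) \<le> (1 / 100 :: real)"
  proof (rule exists_le_expectation_swap[OF finX finite_set_random_code[OF q]])
    fix x
    let ?G = "fst ` support K x"
    show "measure_pmf.expectation (random_code K q t)
     (\<lambda>w. of_bool (real (card (support K x)) \<le> real q / 4 \<and> covered t w ?G)) \<le> (1 / 100 :: real)"
    proof (cases "real (card (support K x)) \<le> real q / 4")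
      case True
      have "card ?G \<le> card (support K x)" by (intro card_image_le) simp
      with True have G: "real (card ?G) \<le> real q / 4" by linarith
      have "measure_pmf.prob (random_code K q t) {w. covered t w ?G} \<le> real (card ?G) * (real (card ?G) / real q) ^ t"
        unfolding covered_def using q
        by (intro prob_random_code_covered) (auto simp: support_def group_elements_def)
      also have "\<dots> \<le> real q / 4 * (1 / 4) ^ t"
        using G q by (intro mult_mono power_mono) (auto simp: field_simps)
      also have "\<dots> \<le> 1 / 100"
        using qt by (simp add: power_divide field_simps)
      finally show ?thesis unfolding expectation_of_bool using True by simp
    qed simp
  qed
  then show ?thesis by (simp only: expectation_of_bool)
qed

text \<open>Outside bad events of total probability at most 8/100, the thinned acceptance is at
  least \<open>99/100 * 5/6 = 33/40\<close>, and \<open>33/40 * 92/100 > 3/4\<close>. The value of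
  \<open>a\<close> makes the expected support size at most \<open>q / 80\<close>, so that Markov's
  inequality at \<open>q / 4\<close> gives 1/20.\<close>

lemma acceptance_of_sparse_weights:
  fixes U :: "real pmf"
  assumes tester: "conjunction_vs_ltf_tester n \<epsilon> m ALG" and n: "2 + q * t \<le> n"
    and q: "q \<ge> 10000" "real q ^ 2 \<le> 64 * real K" and a: "a = 640 * real K / real q"
    and U: "finite (set_pmf U)" "set_pmf U \<subseteq> {0..M}" "measure_pmf.prob U {x. x \<noteq> 0} \<le> 2 / a"
      "measure_pmf.prob U {a} \<ge> 1 / (2 * a)"
    and w: "w \<in> set_pmf (random_code K q t)"
    and cov: "measure_pmf.prob (Pi_pmf (group_elements K) 0 (\<lambda>_. U))
     {x. real (card (support K x)) \<le> real q / 4 \<and> covered t w (fst ` support K x)} \<le> 1 / 100"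
    and M: "M > 0" and R: "real m + 7 \<le> real R / (16 * M)"
  defines "E \<equiv> group_elements K"
  defines "T \<equiv> real (card E) * M"
  shows "3 / 4 \<le> measure_pmf.expectation (Pi_pmf E 0 (\<lambda>_. U))
     (\<lambda>x. thinned_expectation E (\<lambda>e. x e / T) R m (acceptance ALG (code_point n q t w)))"
proof -
  let ?X = "Pi_pmf E 0 (\<lambda>_. U)"
  let ?pt = "code_point n q t w"
  have finE: "finite E" and cardE: "card E = 4 * K" by (simp_all add: E_def)
  have finX: "finite (set_pmf ?X)" using finE U by (intro finite_set_Pi_pmf)
  have "real q ^ 2 > 0" using q by simp
  with q(2) have K: "K > 0" by (cases K) auto
  have apos: "a > 0" using a K q by simp
  have range: "0 \<le> x e \<and> x e \<le> M" if "x \<in> set_pmf ?X" "e \<in> E" for x e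
    using set_Pi_pmf_component[OF that(1) finE that(2)] U(2) by auto
  have T: "T > 0" using M K by (simp add: T_def cardE)
  \<comment> \<open>The bad events: a large support, two support points in one group, a small
    support that the code fails to separate, and a small total weight.\<close>
  define A where "A = {x. real q / 4 \<le> (\<Sum>e\<in>E. of_bool (x e \<noteq> (0::real)))}"
  define B where "B = {x :: nat \<times> bool \<times> bool \<Rightarrow> real. \<not> inj_on fst (support K x)}"
  define C where "C = {x. real (card (support K x)) \<le> real q / 4 \<and> covered t w (fst ` support K x)}"
  define F where "F = {x. sum x E \<le> real (card E) / 8}"
  have "measure_pmf.prob ?X A \<le> real (card E) * measure_pmf.expectation U (\<lambda>y. of_bool (y \<noteq> 0)) / (real q / 4)"
    unfolding A_def using finE U q by (intro prob_sum_Pi_pmf_ge) auto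
  also have "measure_pmf.expectation U (\<lambda>y. of_bool (y \<noteq> 0)) = measure_pmf.prob U {x. x \<noteq> 0}"
    by (rule expectation_of_bool)
  also have "real (card E) * measure_pmf.prob U {x. x \<noteq> 0} / (real q / 4) \<le> real (card E) * (2 / a) / (real q / 4)"
    using U(3) q by (intro divide_right_mono mult_left_mono) auto
  also have "\<dots> = 1 / 20" using K q by (simp add: cardE a)
  finally have A: "measure_pmf.prob ?X A \<le> 1 / 20" .
  have "measure_pmf.prob ?X B \<le> real (16 * K) * (2 / a) ^ 2"
    unfolding B_def E_def using U by (intro prob_support_collision)
  also have "\<dots> = real q ^ 2 / (6400 * real K)" using K q by (simp add: a field_simps power2_eq_square)
  also have "\<dots> \<le> 1 / 100" using q(2) K by (simp add: field_simps)
  finally have B: "measure_pmf.prob ?X B \<le> 1 / 100" .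
  have C: "measure_pmf.prob ?X C \<le> 1 / 100" using cov by (simp add: C_def E_def)
  have "measure_pmf.prob ?X F \<le> exp (- (real (card E) / (8 * a)))"
    unfolding F_def using finE U apos by (intro prob_total_weight_small) auto
  \<comment> \<open>The exponent is \<open>q / 1280\<close>, which exceeds 7 as
    \<open>q \<ge> 10000\<close>.\<close>
  also have "\<dots> \<le> exp (-7)" using q K by (simp add: cardE a)
  also note exp_minus_7_le
  finally have F: "measure_pmf.prob ?X F \<le> 1 / 100" .
  have "measure_pmf.prob ?X (A \<union> B \<union> (C \<union> F)) \<le> measure_pmf.prob ?X (A \<union> B) + measure_pmf.prob ?X (C \<union> F)"
    by (intro measure_Un_le) auto
  also have "\<dots> \<le> (measure_pmf.prob ?X A + measure_pmf.prob ?X B) + (measure_pmf.prob ?X C + measure_pmf.prob ?X F)"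
    by (intro add_mono measure_Un_le) auto
  finally have bad: "measure_pmf.prob ?X (A \<union> B \<union> (C \<union> F)) \<le> 8 / 100"
    using A B C F by linarith
  have sumT: "(\<Sum>e\<in>E. x e / T) \<le> 1" if "x \<in> set_pmf ?X" for x
  proof -
    have "(\<Sum>e\<in>E. x e / T) \<le> (\<Sum>e\<in>E. M / T)"
      using range[OF that] T by (intro sum_mono divide_right_mono) auto
    then show ?thesis using M K by (simp add: T_def cardE)
  qed
  have "33 / 40 * (1 - measure_pmf.prob ?X (A \<union> B \<union> (C \<union> F)))
      \<le> measure_pmf.expectation ?X (\<lambda>x. thinned_expectation E (\<lambda>e. x e / T) R m (acceptance ALG ?pt))"
  proof (rule expectation_ge_of_bad_events[OF finX])
    fix x assume x: "x \<in> set_pmf ?X"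
    have pos: "0 \<le> x e / T" if "e \<in> E" for e using range[OF x that] T by simp
    show "0 \<le> thinned_expectation E (\<lambda>e. x e / T) R m (acceptance ALG ?pt)"
      using thinned_expectation_bounds[of E "\<lambda>e. x e / T" "acceptance ALG ?pt" R m] pos sumT[OF x]
        acceptance_bounds by blast
    assume good: "x \<notin> A \<union> B \<union> (C \<union> F)"
    then have W8: "sum x E > real (card E) / 8" by (simp add: F_def)
    then have W: "sum x E > 0" by (rule order.strict_trans1[rotated]) simp
    have nonneg: "0 \<le> x e" if "e \<in> E" for e using range[OF x that] by simp
    obtain D where D: "\<And>e. e \<in> E \<Longrightarrow> pmf D e = x e / sum x E" "set_pmf D = {e\<in>E. x e \<noteq> 0}"
      using normalised_pmf_exists[OF finE nonneg W] by blast
    have S: "set_pmf D = support K x" using D(2) by (simp add: support_def E_def)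
    have "real (card (support K x)) = (\<Sum>e\<in>E. of_bool (x e \<noteq> 0))"
      using finE by (simp add: support_def E_def Collect_conj_eq)
    with good have "real (card (support K x)) \<le> real q / 4" by (simp add: A_def)
    with good have unc: "\<not> covered t w (fst ` support K x)" and inj: "inj_on fst (support K x)"
      by (auto simp: B_def C_def)
    have "\<exists>f. monotone_conjunction n f \<and> (\<forall>e\<in>support K x. f (?pt e) = xnor_label (?pt e))"
    proof (rule uncovered_code_points_conjunction[OF n])
      show "w j (fst e) < q" if "j < t" "e \<in> support K x" for j e
        using random_code_less[OF _ w that(1), of "fst e"] q that(2) by (auto simp: support_def group_elements_def)
      fix g u v assume guv: "(g, u, v) \<in> support K x" "u \<noteq> v"
      then have "g \<in> fst ` support K x" by force
      with unc obtain j where j: "j < t" "\<And>g'. g' \<in> fst ` support K x - {g} \<Longrightarrow> w j g' \<noteq> w j g"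
        unfolding covered_def by blast
      have "w j g' \<noteq> w j g" if "(g', b, b) \<in> support K x" for g' b
      proof -
        have "g' \<noteq> g" using inj_onD[OF inj _ that guv(1)] guv(2) by auto
        then show ?thesis using that by (intro j(2)) force
      qed
      with j(1) show "\<exists>j<t. \<forall>g' b. (g', b, b) \<in> support K x \<longrightarrow> w j g' \<noteq> w j g" by blast
    qed
    then obtain f where f: "monotone_conjunction n f" "\<And>e. e \<in> support K x \<Longrightarrow> f (?pt e) = xnor_label (?pt e)"
      by blast
    \<comment> \<open>The guarantee of the tester is for the conjunction \<open>f\<close>; samples
      never leave the support, where \<open>f\<close> and \<open>xnor_label\<close> give the same
      labels.\<close>
    have "run_on_samples ALG m (map_pmf ?pt D) f = run_on_samples ALG m (map_pmf ?pt D) xnor_label"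
      using f(2) by (intro run_on_samples_cong) (auto simp: S)
    moreover have "pmf (run_on_samples ALG m (map_pmf ?pt D) f) True \<ge> 5 / 6"
      using tester f(1) set_map_code_point_subset unfolding conjunction_vs_ltf_tester_def by blast
    ultimately have run: "pmf (run_on_samples ALG m (map_pmf ?pt D) xnor_label) True \<ge> 5 / 6" by simp
    define p where "p = sum x E / T"
    have p1: "p \<le> 1" using sumT[OF x] by (simp add: p_def sum_divide_distrib)
    have p0: "p \<ge> 0" using W T by (simp add: p_def)
    have "1 / (8 * M) = (real (card E) / 8) / T" using M K by (simp add: T_def cardE field_simps)
    also have "\<dots> \<le> p" unfolding p_def using W8 T by (intro divide_right_mono) auto
    finally have "1 / (8 * M) * (real R / 2) \<le> p * (real R / 2)" by (intro mult_right_mono) auto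
    also have "p * (real R / 2) = real R * (p / 2)" by simp
    finally have pR: "real m + 7 \<le> real R * (p / 2)" using R by simp
    \<comment> \<open>A trial succeeds with probability \<open>p \<ge> 1 / (8 M)\<close>, so the
      hypothesis on \<open>R\<close> gives \<open>R p / 2 \<ge> m + 7\<close>. Replacing 2 by
      \<open>exp 1\<close> puts the Chernoff bound into a single exponential, at most
      \<open>exp (-7)\<close>.\<close>
    have "2 ^ m * (1 - p / 2) ^ R \<le> exp 1 ^ m * exp (- (p / 2)) ^ R"
    proof (intro mult_mono power_mono)
      show "(2::real) \<le> exp 1" using exp_ge_add_one_self[of "1::real"] by simp
      show "1 - p / 2 \<le> exp (- (p / 2))" using exp_ge_add_one_self[of "- (p / 2)"] by simp
    qed (use p1 in auto)
    also have "\<dots> = exp (real m - real R * (p / 2))"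
      by (simp add: exp_of_nat_mult[symmetric] exp_add[symmetric])
    also have "\<dots> \<le> exp (-7)" using pR by simp
    also note exp_minus_7_le
    finally have tail: "binomial_tail p R m \<ge> 99 / 100"
      using binomial_tail_ge[OF p0 p1, of m R] by simp
    have "33 / 40 = 99 / 100 * (5 / 6 :: real)" by simp
    also have "\<dots> \<le> binomial_tail p R m * pmf (run_on_samples ALG m (map_pmf ?pt D) xnor_label) True"
      using tail run by (intro mult_mono) auto
    also have "\<dots> = thinned_expectation E (\<lambda>e. x e / T) R m (acceptance ALG ?pt)"
      unfolding acceptance_def[abs_def] p_def using D by (intro thinned_expectation_eq_run[OF finE W T, symmetric]) auto
    finally show "33 / 40 \<le> thinned_expectation E (\<lambda>e. x e / T) R m (acceptance ALG ?pt)" .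
  qed simp
  with bad show ?thesis by simp
qed

section \<open>Contradiction and choice of parameters\<close>

text \<open>The acceptance probabilities 3/4 and 7/20 differ by 2/5, while matching moments allow a
  difference of at most \<open>4 K * 4 ^ - L \<le> 1 / 4\<close>.\<close>

lemma no_tester_with_few_samples:
  assumes tester: "conjunction_vs_ltf_tester n \<epsilon> m ALG" and \<epsilon>: "\<epsilon> \<le> 1 / 250" and n: "2 + q * t \<le> n"
    and q: "q \<ge> 10000" "real q ^ 2 \<le> 64 * real K" and qt: "25 * real q \<le> 4 ^ t"
    and a: "a = 640 * real K / real q" "a \<ge> 2"
    and L: "16 * real K \<le> 4 ^ L" and R: "real R \<le> real K * real L / 8"
    and m: "real m + 7 \<le> real R / (16 * (16 * a * real L ^ 2 + a))"
  shows False
proof -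
  define M where "M = 16 * a * real L ^ 2 + a"
  have M: "M > 0" using a by (simp add: M_def add_nonneg_pos)
  have "real q ^ 2 > 0" using q by simp
  with q(2) have K: "K > 0" by (cases K) auto
  obtain U V :: "real pmf" where UV: "finite (set_pmf U)" "finite (set_pmf V)"
    "set_pmf U \<subseteq> {0} \<union> {a..M}" "set_pmf V \<subseteq> {1..M}"
    "\<And>l. l \<le> L \<Longrightarrow> measure_pmf.expectation U (\<lambda>x. x ^ l) = measure_pmf.expectation V (\<lambda>x. x ^ l)"
    "measure_pmf.prob U {x. x \<noteq> 0} \<le> 2 / a" "measure_pmf.prob U {a} \<ge> 1 / (2 * a)"
    "measure_pmf.prob V {x. x \<noteq> 1} \<le> 1 / 100" "measure_pmf.expectation V (\<lambda>x. x) \<le> 4 / 3"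
    unfolding M_def by (rule obtain_moment_matching_pmfs[OF a(2)]) blast
  have range: "set_pmf U \<subseteq> {0..M}" "set_pmf V \<subseteq> {0..M}"
    using UV(3,4) a(2) M by force+
  obtain w where w: "w \<in> set_pmf (random_code K q t)"
      "measure_pmf.prob (Pi_pmf (group_elements K) 0 (\<lambda>_. U))
         {x. real (card (support K x)) \<le> real q / 4 \<and> covered t w (fst ` support K x)} \<le> 1 / 100"
    using exists_uncovering_code[OF UV(1) _ qt, of K] q by auto
  let ?E = "group_elements K"
  let ?F = "\<lambda>x. thinned_expectation ?E (\<lambda>e. x e / (real (card ?E) * M)) R m (acceptance ALG (code_point n q t w))"
  have "3 / 4 \<le> measure_pmf.expectation (Pi_pmf ?E 0 (\<lambda>_. U)) ?F"
    using m unfolding M_def[symmetric]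
    by (intro acceptance_of_sparse_weights[OF tester n q a(1) UV(1) range(1) UV(6,7) w M])
  moreover have "measure_pmf.expectation (Pi_pmf ?E 0 (\<lambda>_. V)) ?F \<le> 7 / 20"
    using n by (intro acceptance_of_spread_weights[OF tester \<epsilon> _ K UV(2,4,8,9)]) auto
  moreover have "\<bar>measure_pmf.expectation (Pi_pmf ?E 0 (\<lambda>_. U)) ?F - measure_pmf.expectation (Pi_pmf ?E 0 (\<lambda>_. V)) ?F\<bar>
      \<le> real (card ?E) * (1 / 4) ^ L"
  proof (rule thinned_expectation_moment_matching[OF _ UV(1,2) range UV(5) M])
    show "2 * real R \<le> real (card ?E) * (real L / 16)" using R by simp
    show "\<bar>acceptance ALG (code_point n q t w) l\<bar> \<le> 1" for l
      using acceptance_bounds[of ALG "code_point n q t w" l] by simp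
  qed simp_all
  moreover have "real (card ?E) * (1 / 4) ^ L \<le> 1 / 4"
    using L by (simp add: power_divide field_simps)
  ultimately show False by linarith
qed

theorem theorem8p5:
  fixes \<epsilon> :: real
  assumes "0 < \<epsilon>" and "\<epsilon> \<le> 1 / 250"
  shows "\<exists>c > 0. \<exists>N. \<forall>n \<ge> N. \<forall>m ALG.
           conjunction_vs_ltf_tester n \<epsilon> m ALG \<longrightarrow>
           real m \<ge> c * (real n / ln (real n) ^ 3)"
proof -
  \<comment> \<open>The additional logarithm in the denominator on the left absorbs both the 7 and
    the large constant, so \<open>c = 1\<close> suffices.\<close>
  have "\<forall>\<^sub>F n in sequentially. real n / ln (real n) ^ 3 + 7 \<le> real n / (100270080 * ln (real n) ^ 2)"
    by real_asymp
  moreover have "\<forall>\<^sub>F n in sequentially. 10000 \<le> real n / (6 * ln (real n))"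
    by real_asymp
  moreover have "\<forall>\<^sub>F n in sequentially. 2 + 3 * ln (real n) \<le> real n / 2"
    by real_asymp
  moreover have "\<forall>\<^sub>F n in sequentially. 1 \<le> ln (real n)"
    by real_asymp
  moreover have "\<forall>\<^sub>F n in sequentially. 100 \<le> n"
    by (rule eventually_ge_at_top)
  ultimately have "\<forall>\<^sub>F n in sequentially. \<forall>m ALG. conjunction_vs_ltf_tester n \<epsilon> m ALG \<longrightarrow>
      real m \<ge> 1 * (real n / ln (real n) ^ 3)"
  proof eventually_elim
    case (elim n)
    show ?case
    proof (intro allI impI, rule ccontr)
      fix m ALG
      assume tester: "conjunction_vs_ltf_tester n \<epsilon> m ALG" and "\<not> 1 * (real n / ln (real n) ^ 3) \<le> real m"
      then have m: "real m + 7 \<le> real n / (100270080 * ln (real n) ^ 2)" using elim(1) by linarith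
      \<comment> \<open>This \<open>t\<close> gives \<open>4 ^ t \<ge> n^2\<close>, enough for the
        code since \<open>25 q \<le> n^2\<close>. Then \<open>4 ^ L \<ge> n^4\<close> exceeds
        \<open>16 K\<close>, as the exchange requires. Up to a remainder, \<open>q\<close> spends
        all coordinates but two on the \<open>t\<close> blocks, and \<open>R\<close> is the largest
        number of trials that the exchange permits.\<close>
      define t where "t = nat \<lceil>2 * ln (real n)\<rceil>"
      define q where "q = (n - 2) div t"
      define K where "K = n ^ 2"
      define L where "L = 2 * t"
      define a where "a = 640 * real K / real q"
      define R where "R = K * L div 8"
      have n: "100 \<le> n" "0 < real n" using elim by auto
      have t: "2 * ln (real n) \<le> real t" "real t \<le> 3 * ln (real n)" "1 \<le> t"
        using elim(4) unfolding t_def by linarith+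
      have four_t: "real n ^ 2 \<le> 4 ^ t"
      proof -
        have "real n ^ 2 = exp (2 * ln (real n))" using n by (simp add: exp_double)
        also have "\<dots> \<le> exp (real t)" using t by simp
        also have "\<dots> = exp 1 ^ t" by (simp add: exp_of_nat_mult[symmetric])
        also have "\<dots> \<le> 4 ^ t" using exp_le by (intro power_mono) auto
        finally show ?thesis .
      qed
      have "real n / (2 * real t) \<le> (real n - 2) / real t - 1"
      proof -
        have "real n / 2 \<le> real n - 2 - real t" using elim(3) t by linarith
        then have "(real n / 2) / real t \<le> (real n - 2 - real t) / real t" by (intro divide_right_mono) auto
        then show ?thesis using t by (simp add: diff_divide_distrib)
      qed
      also have "\<dots> \<le> real q"
      proof -
        have "n - 2 < t + t * q" using t dividend_less_times_div[of t "n - 2"] by (simp add: q_def)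
        then have "real (n - 2) < real t + real t * real q"
          by (metis of_nat_add of_nat_less_iff of_nat_mult)
        then have "real (n - 2) / real t - 1 < real q" using t by (simp add: field_simps)
        then show ?thesis using n by (simp add: of_nat_diff)
      qed
      finally have q_ge: "real n / (2 * real t) \<le> real q" .
      have "10000 \<le> real n / (6 * ln (real n))" by (rule elim(2))
      also have "\<dots> \<le> real n / (2 * real t)" using t n by (intro divide_left_mono) auto
      finally have q10000: "10000 \<le> q" using q_ge by simp
      have qn: "q \<le> n" unfolding q_def by (meson diff_le_self div_le_dividend order.trans)
      show False
      proof (rule no_tester_with_few_samples[OF tester assms(2) _ q10000 _ _ a_def])
        have "q * t \<le> n - 2" unfolding q_def by simp
        then show "2 + q * t \<le> n" using n by simp
        have "real q ^ 2 \<le> real n ^ 2" using qn by (intro power_mono) auto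
        also have "\<dots> \<le> 64 * real K" by (simp add: K_def)
        finally show "real q ^ 2 \<le> 64 * real K" .
        have "25 * real q \<le> real n * real n" using qn n by (intro mult_mono) auto
        also have "\<dots> \<le> 4 ^ t" using four_t by (simp add: power2_eq_square)
        finally show "25 * real q \<le> 4 ^ t" .
        have "real q \<le> real n" "real n \<le> real n ^ 2" "real K = real n ^ 2"
          using qn n self_le_power[of "real n" 2] by (simp_all add: K_def)
        then have "2 * real q \<le> 640 * real K" by linarith
        then show "2 \<le> a" using q10000 by (simp add: a_def field_simps)
        have n_sq: "10000 \<le> real n ^ 2" using n power_mono[of 100 "real n" 2] by simp
        then have "16 * real n ^ 2 \<le> real n ^ 2 * real n ^ 2" by (intro mult_right_mono) auto
        then have "16 * real K \<le> real n ^ 2 * real n ^ 2" by (simp add: K_def)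
        also have "\<dots> \<le> 4 ^ t * 4 ^ t" using four_t by (intro mult_mono) auto
        finally show "16 * real K \<le> 4 ^ L" by (simp add: L_def power_add mult_2)
        have "8 * R \<le> K * L" "K * L < 8 + 8 * R"
          unfolding R_def using dividend_less_times_div[of 8 "K * L"] by simp_all
        then have "real (8 * R) \<le> real (K * L)" "real (K * L) < real (8 + 8 * R)"
          by (simp_all only: of_nat_le_iff of_nat_less_iff)
        then have "8 * real R \<le> real K * real L" "real K * real L < 8 + 8 * real R"
          by simp_all
        then show "real R \<le> real K * real L / 8" by simp
        have Lpos: "real L \<ge> 2" using t by (simp add: L_def)
        have apos: "a > 0" using q10000 n by (simp add: a_def K_def)
        have "real K * real L \<ge> 10000 * 2" using n_sq Lpos by (intro mult_mono) (auto simp: K_def)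
        then have R_ge: "real K * real L / 16 \<le> real R"
          using \<open>real K * real L < 8 + 8 * real R\<close> by linarith
        have "16 * a * real L ^ 2 + a \<le> 16 * a * real L ^ 2 + a * real L ^ 2"
          using apos Lpos by simp
        then have M_le: "16 * a * real L ^ 2 + a \<le> 17 * a * real L ^ 2" by simp
        \<comment> \<open>Origin of the constant: \<open>2785280 = 16 * 16 * 17 * 640\<close>. The
          estimate \<open>q \<ge> n / (2 t)\<close> together with \<open>L = 2 t\<close> adds a
          factor 4, and \<open>t \<le> 3 ln n\<close> a factor 9.\<close>
        have "real n / (100270080 * ln (real n) ^ 2) = (real n / 11141120) / (3 * ln (real n)) ^ 2"
          by (simp add: power_mult_distrib)
        also have "\<dots> \<le> (real n / 11141120) / real t ^ 2"
          using t elim(4) by (intro divide_left_mono power_mono mult_pos_pos) auto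
        also have "\<dots> = (real n / (2 * real t)) / (2785280 * real L)"
          using t by (simp add: L_def power2_eq_square)
        also have "\<dots> \<le> real q / (2785280 * real L)"
          using q_ge Lpos by (intro divide_right_mono) auto
        also have "\<dots> = (real K * real L / 16) / (16 * (17 * a * real L ^ 2))"
          using Lpos q10000 n by (simp add: a_def K_def power2_eq_square)
        also have "\<dots> \<le> real R / (16 * (16 * a * real L ^ 2 + a))"
          using R_ge M_le apos Lpos by (intro frac_le) (auto intro!: add_nonneg_pos)
        finally show "real m + 7 \<le> real R / (16 * (16 * a * real L ^ 2 + a))" using m by linarith
      qed
    qed
  qed
  then obtain N where "\<forall>n\<ge>N. \<forall>m ALG. conjunction_vs_ltf_tester n \<epsilon> m ALG \<longrightarrow>
      real m \<ge> 1 * (real n / ln (real n) ^ 3)"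
    unfolding eventually_sequentially by blast
  then show ?thesis by (intro exI[of _ 1] conjI exI[of _ N]) auto
qed

end
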